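(* In the layered network described in the context, assume $k_i\ge 2$ for all $i=1,\dots,l$. Then the VC-dimension of the class $\Phi=\{\phi(w,\cdot):w\in\mathbb{R}^k\}$ of $\{0,1\}$-valued functions on $\mathbb{R}^N$ satisfies $$\mathrm{VCdim}(\Phi)\;\le\;2k\big(\log_2(4ed)-H(\mathbf v|\mathbf u)\big).$$
   Context: Network architecture: fix integers $N\ge 1$, $l\ge 1$, layer widths $q_0:=N$, $q_1,\dots,q_{l-1}\ge 1$, $q_l:=1$, block sizes $k_1,\dots,k_l\ge 1$ with $k:=\sum_i k_i$, and positive integers $\alpha_1,\dots,\alpha_l$, $\beta_1,\dots,\beta_l$. The weight vector is $w=(w_1,\dots,w_l)\in\mathbb{R}^k$ with $w_i\in\mathbb{R}^{k_i}$. For each $i$ and $j\in\{1,\dots,q_i\}$, $\tau_{i,j}:\mathbb{R}^{k_i}\times\mathbb{R}^{q_{i-1}}\to\mathbb{R}$ is a real polynomial of total degree at most $\alpha_i$ in the coordinates of $w_i$ and of total degree at most $\beta_i$ in the remaining $q_{i-1}$ variables. For an input $x\in\mathbb{R}^N$ set $y_0:=x$ and recursively $y_{i,j}(w,x):=\tau_{i,j}(w_i,y_{i-1,1}(w,x),\dots,y_{i-1,q_{i-1}}(w,x))$; the network output is $y_l(w,x):=y_{l,1}(w,x)$, and the network computes $\phi(w,x)=1$ if $y_l(w,x)\ge 0$ and $\phi(w,x)=0$ otherwise. Define $d_l:=\alpha_l$, $d_i:=\alpha_i\prod_{j=i+1}^l\beta_j$ for $i<l$, $d:=\sum_{i=1}^l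 d_i$, probability vectors $\mathbf v:=(k_1/k,\dots,k_l/k)$, $\mathbf u:=(d_1/d,\dots,d_l/d)$, and $H(\mathbf v|\mathbf u):=\sum_{i=1}^l v_i\log_2(v_i/u_i)$. A finite set $S\subseteq\mathbb{R}^N$ is shattered by $\Phi$ if every function $S\to\{0,1\}$ is the restriction of some member of $\Phi$; $\mathrm{VCdim}(\Phi)$ is the largest cardinality of a shattered set. Here $e$ is Euler's number. *)

theory Defs
  imports Complex_Main
begin

text \<open>Vectors in R^n are represented as functions nat => real, of which only the
  coordinates 0..n-1 matter.\<close>

definition exps :: "nat \<Rightarrow> nat \<Rightarrow> (nat \<Rightarrow> nat) set" where
  "exps n d = {e. (\<forall>i\<ge>n. e i = 0) \<and> (\<Sum>i<n. e i) \<le> d}"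

definition poly_bideg ::
  "nat \<Rightarrow> nat \<Rightarrow> nat \<Rightarrow> nat \<Rightarrow> ((nat \<Rightarrow> real) \<Rightarrow> (nat \<Rightarrow> real) \<Rightarrow> real) \<Rightarrow> bool" where
  "poly_bideg m n a b f \<longleftrightarrow>
     (\<exists>c :: (nat \<Rightarrow> nat) \<Rightarrow> (nat \<Rightarrow> nat) \<Rightarrow> real. \<forall>w y.
        f w y = (\<Sum>e\<in>exps m a. \<Sum>g\<in>exps n b.
                   c e g * (\<Prod>i<m. w i ^ e i) * (\<Prod>j<n. y j ^ g j)))"

fun layer_out ::
  "(nat \<Rightarrow> nat \<Rightarrow> (nat \<Rightarrow> real) \<Rightarrow> (nat \<Rightarrow> real) \<Rightarrow> real) \<Rightarrow>
   (nat \<Rightarrow> nat \<Rightarrow> real) \<Rightarrow> (nat \<Rightarrow> real) \<Rightarrow> nat \<Rightarrow> nat \<Rightarrow> real" where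
  "layer_out \<tau> W x 0 = x"
| "layer_out \<tau> W x (Suc i) = (\<lambda>j. \<tau> (Suc i) j (W (Suc i)) (layer_out \<tau> W x i))"

definition net_phi ::
  "(nat \<Rightarrow> nat \<Rightarrow> (nat \<Rightarrow> real) \<Rightarrow> (nat \<Rightarrow> real) \<Rightarrow> real) \<Rightarrow> nat \<Rightarrow>
   (nat \<Rightarrow> nat \<Rightarrow> real) \<Rightarrow> (nat \<Rightarrow> real) \<Rightarrow> bool" where
  "net_phi \<tau> l W x \<longleftrightarrow> 0 \<le> layer_out \<tau> W x l 0"

definition shatters :: "('a \<Rightarrow> bool) set \<Rightarrow> 'a set \<Rightarrow> bool" where
  "shatters F S \<longleftrightarrow> (\<forall>T\<subseteq>S. \<exists>f\<in>F. \<forall>x\<in>S. f x \<longleftrightarrow> x \<in> T)"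

definition vcdim_le :: "'a set \<Rightarrow> ('a \<Rightarrow> bool) set \<Rightarrow> real \<Rightarrow> bool" where
  "vcdim_le X F B \<longleftrightarrow> (\<forall>S. finite S \<and> S \<subseteq> X \<and> shatters F S \<longrightarrow> real (card S) \<le> B)"

definition dcoef :: "nat \<Rightarrow> (nat \<Rightarrow> nat) \<Rightarrow> (nat \<Rightarrow> nat) \<Rightarrow> nat \<Rightarrow> nat" where
  "dcoef l \<alpha> \<beta> i = \<alpha> i * (\<Prod>j\<in>{i+1..l}. \<beta> j)"

definition rel_entropy :: "nat \<Rightarrow> (nat \<Rightarrow> real) \<Rightarrow> (nat \<Rightarrow> real) \<Rightarrow> real" where
  "rel_entropy l v u = (\<Sum>i=1..l. v i * log 2 (v i / u i))"

end

theory Submission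
  imports Defs "HOL-Analysis.Function_Topology" "HOL-Computational_Algebra.Polynomial"
begin

text \<open>
  For each of the \<open>m\<close> inputs the network output is a polynomial in the weights whose degree in
  the block \<open>w_i\<close> is at most \<open>d_i\<close>.  A sign pattern of these polynomials is charged to
  the minimiser of a strongly penalised squared distance to a generic point; it determines the pattern,
  and for generic thresholds at most \<open>k\<close> of the \<open>2m\<close> penalties are active there.  For a given
  active set the minimiser solves \<open>k\<close> polynomial equations of block degrees \<open>2 d_i\<close> with
  generic right-hand side, and such a system has at most
  \<open>k! * (\<Prod>i. (2 d_i) ^ k_i / k_i!)\<close> solutions.  This multihomogeneous Bezout bound is a dimension
  count: if a linear form took more values on a generic fibre, its powers times the monomials in the
  equations would be linearly independent, and for high degree there are too many of them.
  Hence \<open>2 ^ m \<le> (\<Sum>s\<le>k. 2m choose s) * k! * (\<Prod>i. (2 d_i) ^ k_i / k_i!)\<close>, which is solved for \<open>m\<close>.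
\<close>

section \<open>Polynomials of bounded block degree\<close>

text \<open>Bounds of this kind usually rest on nondegenerate solutions and on intersection theory
  for block degrees. Neither is used here: the fibre bound counts only values of a linear form, so
  multiplicities and Jacobians never occur. The squared distance to \<open>p\<close> serves twice.
  It makes the objective coercive, and it puts \<open>p\<close> alone on the right of the critical
  equations, so that a generic \<open>p\<close> is a generic right-hand side. Penalties are squared
  positive parts. Once the active set is known, their gradient is polynomial, a sum of products of
  \<open>f s - \<delta> s\<close> with a derivative of \<open>f s\<close>; this doubles the degrees.
  One penalty per input and sign allows the thresholds to be fixed before the pattern, which doubles
  \<open>m\<close>. The order of choices matters: thresholds, then penalty weight, then
  \<open>p\<close>, because the exceptional set for \<open>p\<close> depends on the first two. The
  entropy comes from the multinomial coefficient, which is at most the product of the (k / k_i) ^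
  k_i.\<close>

lemma homogeneous_system_nontrivial_solution:
  fixes m :: "'e \<Rightarrow> 'a \<Rightarrow> real"
  assumes "finite E" "finite A" "card E < card A"
  shows "\<exists>c. (\<exists>a\<in>A. c a \<noteq> 0) \<and> (\<forall>e\<in>E. (\<Sum>a\<in>A. c a * m e a) = 0)"
  using assms
proof (induction E arbitrary: A m rule: finite_induct)
  case empty
  then have "A \<noteq> {}" by auto
  then show ?case by (intro exI[of _ "\<lambda>_. 1"]) auto
next
  case (insert e E)
  show ?case
  proof (cases "\<forall>a\<in>A. m e a = 0")
    case True
    from insert.prems insert.hyps have "card E < card A" by simp
    from insert.IH[OF insert.prems(1) this, of m] True show ?thesis by force
  next
    case False
    then obtain z where z: "z \<in> A" "m e z \<noteq> 0" by blast
    define A' where "A' = A - {z}"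
    have A': "finite A'" "A = insert z A'" "z \<notin> A'" "card E < card A'"
      using insert.prems insert.hyps z by (auto simp: A'_def)
    \<comment> \<open>Gaussian elimination: equation \<open>e\<close> is solved for the unknown
      \<open>z\<close> and substituted into the others; \<open>c'\<close> restores the value of
      \<open>z\<close>.\<close>
    define m' where "m' = (\<lambda>e' a. m e' a - m e' z * (m e a / m e z))"
    obtain c where c: "\<exists>a\<in>A'. c a \<noteq> 0" "\<forall>e'\<in>E. (\<Sum>a\<in>A'. c a * m' e' a) = 0"
      using insert.IH[OF A'(1,4), of m'] by blast
    define s where "s = (\<Sum>a\<in>A'. c a * m e a)"
    define c' where "c' = c(z := - s / m e z)"
    have split: "(\<Sum>a\<in>A. c' a * m e' a) = - s / m e z * m e' z + (\<Sum>a\<in>A'. c a * m e' a)" for e'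
    proof -
      have "(\<Sum>a\<in>A'. c' a * m e' a) = (\<Sum>a\<in>A'. c a * m e' a)"
        using A'(3) by (intro sum.cong) (auto simp: c'_def)
      then show ?thesis
        using A' by (simp add: c'_def)
    qed
    have "(\<Sum>a\<in>A. c' a * m e' a) = 0" if "e' \<in> insert e E" for e'
    proof (cases "e' = e")
      case True
      then show ?thesis using z split[of e] by (simp add: s_def)
    next
      case False
      then have "0 = (\<Sum>a\<in>A'. c a * m' e' a)" using c(2) that by auto
      also have "\<dots> = (\<Sum>a\<in>A'. c a * m e' a - m e' z / m e z * (c a * m e a))"
        by (intro sum.cong) (auto simp: m'_def algebra_simps)
      also have "\<dots> = (\<Sum>a\<in>A'. c a * m e' a) - m e' z / m e z * s"
        by (simp add: sum_subtractf sum_distrib_left s_def)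
      finally show ?thesis using split[of e'] by simp
    qed
    moreover have "\<exists>a\<in>A. c' a \<noteq> 0" using c(1) A' by (auto simp: c'_def)
    ultimately show ?thesis by blast
  qed
qed

text \<open>Exponents vanish off \<open>V\<close>, so that a monomial has only one exponent function
  and counting these functions counts monomials.\<close>

definition exponents :: "'v set \<Rightarrow> nat \<Rightarrow> ('v \<Rightarrow> nat) set" where
  "exponents V n = {e. (\<forall>v. v \<notin> V \<longrightarrow> e v = 0) \<and> sum e V \<le> n}"

definition block_exponents :: "'v set \<Rightarrow> ('v \<Rightarrow> 'b) \<Rightarrow> ('b \<Rightarrow> nat) \<Rightarrow> ('v \<Rightarrow> nat) set" where
  "block_exponents V b D =
     {e. (\<forall>v. v \<notin> V \<longrightarrow> e v = 0) \<and> (\<forall>i. (\<Sum>v\<in>{v\<in>V. b v = i}. e v) \<le> D i)}"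

definition monomial :: "'v set \<Rightarrow> ('v \<Rightarrow> nat) \<Rightarrow> ('v \<Rightarrow> real) \<Rightarrow> real" where
  "monomial V e w = (\<Prod>v\<in>V. w v ^ e v)"

definition block_poly ::
  "'v set \<Rightarrow> ('v \<Rightarrow> 'b) \<Rightarrow> ('b \<Rightarrow> nat) \<Rightarrow> (('v \<Rightarrow> real) \<Rightarrow> real) \<Rightarrow> bool" where
  "block_poly V b D f \<longleftrightarrow>
     (\<exists>c. \<forall>w. f w = (\<Sum>e\<in>block_exponents V b D. c e * monomial V e w))"

text \<open>If the new variable has exponent \<open>r\<close>, degree \<open>n - r\<close> remains
  for the others; the sum over \<open>r\<close> is the hockey-stick identity.\<close>

lemma finite_card_exponents:
  assumes "finite V"
  shows "finite (exponents V n) \<and> card (exponents V n) = (n + card V) choose card V"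
  using assms
proof (induction V arbitrary: n rule: finite_induct)
  case empty
  have "exponents {} n = {\<lambda>_::'a. 0}" by (auto simp: exponents_def)
  then show ?case by simp
next
  case (insert u V)
  let ?A = "SIGMA r:{..n}. exponents V (n - r)"
  let ?f = "\<lambda>(r::nat, e). e(u := r)"
  have sum_upd: "(\<Sum>x\<in>V. if x = u then r else e x) = sum e V" for e :: "'a \<Rightarrow> nat" and r
    using insert.hyps by (intro sum.cong) auto
  have bij: "bij_betw ?f ?A (exponents (insert u V) n)"
  proof (intro bij_betwI[where g = "\<lambda>e. (e u, e(u := 0))"])
    show "?f \<in> ?A \<rightarrow> exponents (insert u V) n"
      using insert.hyps by (auto simp: exponents_def sum_upd)
    show "(\<lambda>e. (e u, e(u := 0))) \<in> exponents (insert u V) n \<rightarrow> ?A"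
      using insert.hyps by (auto simp: exponents_def sum_upd)
    show "(\<lambda>e. (e u, e(u := 0))) (?f x) = x" if "x \<in> ?A" for x
      using that insert.hyps by (auto simp: exponents_def fun_eq_iff)
    show "?f (e u, e(u := 0)) = e" for e by auto
  qed
  have "card (exponents (insert u V) n) = card ?A"
    using bij_betw_same_card[OF bij] by simp
  also have "\<dots> = (\<Sum>r\<le>n. (n - r + card V) choose card V)"
    using insert.IH by simp
  also have "\<dots> = (\<Sum>r\<le>n. (card V + r) choose card V)"
    using sum.nat_diff_reindex[of "\<lambda>r. (card V + r) choose card V" "Suc n"]
    by (simp add: lessThan_Suc_atMost add.commute)
  also have "\<dots> = (n + card (insert u V)) choose card (insert u V)"
    using insert.hyps choose_rising_sum[of "card V" n] by (simp add: add.commute)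
  finally show ?case
    using bij_betw_finite[OF bij] insert.IH by auto
qed

text \<open>An exponent is determined by its restrictions to the blocks, and these are counted
  independently. Only an upper bound is needed, so an injection suffices.\<close>

lemma finite_card_block_exponents:
  assumes "finite V"
  shows "finite (block_exponents V b D) \<and>
    card (block_exponents V b D)
      \<le> (\<Prod>i\<in>b ` V. (D i + card {v\<in>V. b v = i}) choose card {v\<in>V. b v = i})"
proof -
  let ?V = "\<lambda>i. {v\<in>V. b v = i}"
  let ?P = "PiE (b ` V) (\<lambda>i. exponents (?V i) (D i))"
  let ?f = "\<lambda>e. \<lambda>i\<in>b ` V. (\<lambda>v. if v \<in> ?V i then e v else 0)"
  have fin: "finite (?V i)" for i using assms by simp
  have finP: "finite ?P"
    using assms finite_card_exponents[OF fin] by (intro finite_PiE) auto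
  have into: "?f ` block_exponents V b D \<subseteq> ?P"
  proof (intro image_subsetI PiE_I)
    fix e i assume e: "e \<in> block_exponents V b D"
    have "(\<Sum>v\<in>?V i. if v \<in> ?V i then e v else 0) = sum e (?V i)"
      by (intro sum.cong) auto
    then have "(\<lambda>v. if v \<in> ?V i then e v else 0) \<in> exponents (?V i) (D i)"
      using e by (auto simp: exponents_def block_exponents_def)
    then show "i \<in> b ` V \<Longrightarrow> ?f e i \<in> exponents (?V i) (D i)" by simp
    show "i \<notin> b ` V \<Longrightarrow> ?f e i = undefined" by simp
  qed
  have inj: "inj_on ?f (block_exponents V b D)"
  proof (rule inj_onI)
    fix e e' assume *: "e \<in> block_exponents V b D" "e' \<in> block_exponents V b D" "?f e = ?f e'"
    show "e = e'"
    proof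
      fix v show "e v = e' v"
      proof (cases "v \<in> V")
        case True
        then show ?thesis using fun_cong[OF fun_cong[OF *(3), of "b v"], of v] by simp
      next
        case False
        then show ?thesis using *(1,2) by (simp add: block_exponents_def)
      qed
    qed
  qed
  have "card (block_exponents V b D) \<le> card ?P"
    by (rule card_inj_on_le[OF inj into finP])
  also have "card ?P = (\<Prod>i\<in>b ` V. (D i + card (?V i)) choose card (?V i))"
    using assms finite_card_exponents[OF fin] by (simp add: card_PiE)
  finally show ?thesis
    using inj_on_finite[OF inj into finP] by blast
qed

lemma monomial_add: "monomial V (\<lambda>v. e v + e' v) w = monomial V e w * monomial V e' w"
  by (simp add: monomial_def power_add prod.distrib)

lemma block_exponents_add:
  assumes "e \<in> block_exponents V b D" "e' \<in> block_exponents V b D'"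
  shows "(\<lambda>v. e v + e' v) \<in> block_exponents V b (\<lambda>i. D i + D' i)"
  using assms by (auto simp: block_exponents_def sum.distrib intro!: add_mono)

lemma block_exponents_mono:
  assumes "\<And>i. i \<in> b ` V \<Longrightarrow> D i \<le> D' i"
  shows "block_exponents V b D \<subseteq> block_exponents V b D'"
proof
  fix e assume e: "e \<in> block_exponents V b D"
  have "(\<Sum>v\<in>{v\<in>V. b v = i}. e v) \<le> D' i" for i
  proof (cases "i \<in> b ` V")
    case True
    have "(\<Sum>v\<in>{v\<in>V. b v = i}. e v) \<le> D i" using e by (simp add: block_exponents_def)
    also have "\<dots> \<le> D' i" using assms[OF True] .
    finally show ?thesis .
  next
    case False
    then have "{v\<in>V. b v = i} = {}" by auto
    then show ?thesis by (simp only: sum.empty)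
  qed
  then show "e \<in> block_exponents V b D'" using e by (auto simp: block_exponents_def)
qed

section \<open>Ring operations, derivatives and linear dependence of block polynomials\<close>

context
  fixes V :: "'v set" and b :: "'v \<Rightarrow> 'b"
  assumes fin_V: "finite V"
begin

lemma finite_block_exponents: "finite (block_exponents V b D)"
  using finite_card_block_exponents[OF fin_V] by blast

lemma block_poly_monomial:
  assumes "e \<in> block_exponents V b D"
  shows "block_poly V b D (\<lambda>w. a * monomial V e w)"
  unfolding block_poly_def
proof (intro exI allI)
  fix w :: "'v \<Rightarrow> real"
  show "a * monomial V e w =
    (\<Sum>e'\<in>block_exponents V b D. (if e' = e then a else 0) * monomial V e' w)"
    using assms finite_block_exponents
    by (simp add: if_distrib[of "\<lambda>x. x * _"] cong: if_cong)
qed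

lemma block_poly_mono:
  assumes "block_poly V b D f" "\<And>i. i \<in> b ` V \<Longrightarrow> D i \<le> D' i"
  shows "block_poly V b D' f"
proof -
  from assms(1) obtain c
    where c: "\<And>w. f w = (\<Sum>e\<in>block_exponents V b D. c e * monomial V e w)"
    by (auto simp: block_poly_def)
  have "f w = (\<Sum>e\<in>block_exponents V b D'.
      (if e \<in> block_exponents V b D then c e else 0) * monomial V e w)" for w
    unfolding c using block_exponents_mono[of b V D D', OF assms(2)]
    by (intro sum.mono_neutral_cong_left) (auto simp: finite_block_exponents)
  then show ?thesis
    unfolding block_poly_def by (intro exI allI)
qed

lemma block_poly_const: "block_poly V b D (\<lambda>w. a)"
proof -
  have "(\<lambda>_. 0) \<in> block_exponents V b D" by (simp add: block_exponents_def)
  from block_poly_monomial[OF this, of a] show ?thesis by (simp add: monomial_def)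
qed

lemma block_poly_add:
  assumes "block_poly V b D f" "block_poly V b D g"
  shows "block_poly V b D (\<lambda>w. f w + g w)"
proof -
  from assms obtain c c'
    where "\<And>w. f w = (\<Sum>e\<in>block_exponents V b D. c e * monomial V e w)"
      "\<And>w. g w = (\<Sum>e\<in>block_exponents V b D. c' e * monomial V e w)"
    by (auto simp: block_poly_def)
  then have "f w + g w = (\<Sum>e\<in>block_exponents V b D. (c e + c' e) * monomial V e w)" for w
    by (simp add: sum.distrib distrib_right)
  then show ?thesis unfolding block_poly_def by (intro exI allI)
qed

lemma block_poly_sum:
  assumes "\<And>a. a \<in> A \<Longrightarrow> block_poly V b D (f a)"
  shows "block_poly V b D (\<lambda>w. \<Sum>a\<in>A. f a w)"
  using assms
  by (induction A rule: infinite_finite_induct) (simp_all add: block_poly_const block_poly_add)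

lemma block_poly_mult:
  assumes "block_poly V b D f" "block_poly V b D' g"
  shows "block_poly V b (\<lambda>i. D i + D' i) (\<lambda>w. f w * g w)"
proof -
  from assms obtain c c'
    where c: "\<And>w. f w = (\<Sum>e\<in>block_exponents V b D. c e * monomial V e w)"
      "\<And>w. g w = (\<Sum>e\<in>block_exponents V b D'. c' e * monomial V e w)"
    by (auto simp: block_poly_def)
  have "f w * g w = (\<Sum>e\<in>block_exponents V b D. \<Sum>e'\<in>block_exponents V b D'.
      (c e * c' e') * monomial V (\<lambda>v. e v + e' v) w)" for w
    unfolding c sum_product monomial_add by (intro sum.cong refl) (simp add: mult_ac)
  moreover have "block_poly V b (\<lambda>i. D i + D' i)
      (\<lambda>w. \<Sum>e\<in>block_exponents V b D. \<Sum>e'\<in>block_exponents V b D'.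
        (c e * c' e') * monomial V (\<lambda>v. e v + e' v) w)"
    by (intro block_poly_sum block_poly_monomial block_exponents_add)
  ultimately show ?thesis by (simp add: block_poly_def)
qed

lemma block_poly_cmult:
  assumes "block_poly V b D f"
  shows "block_poly V b D (\<lambda>w. a * f w)"
  using block_poly_mult[OF block_poly_const[of "\<lambda>_. 0"] assms] by simp

lemma block_poly_power:
  assumes "block_poly V b D f"
  shows "block_poly V b (\<lambda>i. n * D i) (\<lambda>w. f w ^ n)"
  by (induction n) (use block_poly_const block_poly_mult[OF assms] in simp_all)

lemma block_poly_prod:
  assumes "\<And>a. a \<in> A \<Longrightarrow> block_poly V b (D a) (f a)"
  shows "block_poly V b (\<lambda>i. \<Sum>a\<in>A. D a i) (\<lambda>w. \<Prod>a\<in>A. f a w)"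
  using assms
  by (induction A rule: infinite_finite_induct) (simp_all add: block_poly_const block_poly_mult)

lemma block_poly_var:
  assumes "v \<in> V"
  shows "block_poly V b (\<lambda>i. if i = b v then 1 else 0) (\<lambda>w. w v)"
proof -
  let ?e = "\<lambda>u. if u = v then 1 else 0 :: nat"
  have "(\<Sum>u\<in>{u\<in>V. b u = i}. ?e u) \<le> (if i = b v then 1 else 0)" for i
    using fin_V by simp
  then have "?e \<in> block_exponents V b (\<lambda>i. if i = b v then 1 else 0)"
    using assms by (auto simp: block_exponents_def)
  moreover have "monomial V ?e w = w v" for w
    using assms fin_V by (simp add: monomial_def if_distrib[of "\<lambda>n. _ ^ n"] cong: if_cong)
  ultimately show ?thesis using block_poly_monomial[of ?e _ 1] by simp
qed

lemma block_poly_has_partial_derivative: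
  assumes "block_poly V b D f" "v \<in> V"
  obtains f' where "block_poly V b D f'"
    and "\<And>w. ((\<lambda>t. f (w(v := t))) has_real_derivative f' w) (at (w v))"
proof -
  from assms(1) obtain c
    where c: "\<And>w. f w = (\<Sum>e\<in>block_exponents V b D. c e * monomial V e w)"
    by (auto simp: block_poly_def)
  \<comment> \<open>For \<open>e v = 0\<close> the truncated \<open>e v - 1\<close> is harmless,
    because the coefficient has the factor \<open>e v\<close>.\<close>
  let ?d = "\<lambda>e. e(v := e v - 1)"
  let ?f' = "\<lambda>w. \<Sum>e\<in>block_exponents V b D. (c e * real (e v)) * monomial V (?d e) w"
  have split: "monomial V e w = w v ^ e v * (\<Prod>u\<in>V-{v}. w u ^ e u)" for e and w :: "'v \<Rightarrow> real"
    using fin_V assms(2) by (simp add: monomial_def prod.remove)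
  have others: "(\<Prod>u\<in>V-{v}. (w(v := t)) u ^ e u) = (\<Prod>u\<in>V-{v}. w u ^ e u)"
    for w :: "'v \<Rightarrow> real" and t e
    by (intro prod.cong) auto
  have others': "(\<Prod>u\<in>V-{v}. w u ^ ?d e u) = (\<Prod>u\<in>V-{v}. w u ^ e u)"
    for w :: "'v \<Rightarrow> real" and e
    by (intro prod.cong) auto
  have "?d e \<in> block_exponents V b D" if "e \<in> block_exponents V b D" for e
  proof -
    have le: "(\<Sum>u\<in>{u\<in>V. b u = i}. ?d e u) \<le> (\<Sum>u\<in>{u\<in>V. b u = i}. e u)" for i
      by (intro sum_mono) auto
    then show ?thesis
      using that order_trans[OF le] by (simp add: block_exponents_def)
  qed
  then have "block_poly V b D ?f'"
    by (intro block_poly_sum block_poly_monomial)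
  moreover have "((\<lambda>t. f (w(v := t))) has_real_derivative ?f' w) (at (w v))" for w
    unfolding c
  proof (rule DERIV_sum)
    fix e
    show "((\<lambda>t. c e * monomial V e (w(v := t))) has_real_derivative
        (c e * real (e v)) * monomial V (?d e) w) (at (w v))"
      unfolding split others others' by (auto intro!: derivative_eq_intros)
  qed
  ultimately show thesis using that by blast
qed

lemma block_poly_continuous:
  assumes "block_poly V b D f"
  shows "continuous_on UNIV f"
proof -
  from assms obtain c
    where c: "f = (\<lambda>w. \<Sum>e\<in>block_exponents V b D. c e * monomial V e w)"
    by (auto simp: block_poly_def)
  show ?thesis
    unfolding c monomial_def by (intro continuous_intros continuous_on_product_coordinates)
qed

lemma block_poly_cong:
  assumes "block_poly V b D f" "\<And>v. v \<in> V \<Longrightarrow> w v = w' v"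
  shows "f w = f w'"
proof -
  have "monomial V e w = monomial V e w'" for e
    using assms(2) by (simp add: monomial_def)
  then show ?thesis using assms(1) by (auto simp: block_poly_def)
qed

text \<open>The source of every algebraic relation below: the unknowns are the coefficients of the
  relation, with one linear equation for each exponent.\<close>

lemma block_polys_linearly_dependent:
  assumes "finite A" "card (block_exponents V b D) < card A"
    and "\<And>a. a \<in> A \<Longrightarrow> block_poly V b D (f a)"
  shows "\<exists>c. (\<exists>a\<in>A. c a \<noteq> 0) \<and> (\<forall>w. (\<Sum>a\<in>A. c a * f a w) = 0)"
proof -
  have "\<forall>a\<in>A. \<exists>m. \<forall>w. f a w = (\<Sum>e\<in>block_exponents V b D. m e * monomial V e w)"
    using assms(3) by (simp add: block_poly_def)
  then obtain m where m:
    "\<And>a w. a \<in> A \<Longrightarrow> f a w = (\<Sum>e\<in>block_exponents V b D. m a e * monomial V e w)"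
    by metis
  obtain c where c: "\<exists>a\<in>A. c a \<noteq> 0"
      "\<forall>e\<in>block_exponents V b D. (\<Sum>a\<in>A. c a * m a e) = 0"
    using homogeneous_system_nontrivial_solution[OF finite_block_exponents assms(1,2),
        of "\<lambda>e a. m a e"] by blast
  have "(\<Sum>a\<in>A. c a * f a w) = 0" for w
  proof -
    have "(\<Sum>a\<in>A. c a * f a w)
        = (\<Sum>a\<in>A. \<Sum>e\<in>block_exponents V b D. (c a * m a e) * monomial V e w)"
      by (intro sum.cong) (auto simp: m sum_distrib_left mult.assoc)
    also have "\<dots> = (\<Sum>e\<in>block_exponents V b D. (\<Sum>a\<in>A. c a * m a e) * monomial V e w)"
      by (subst sum.swap) (simp add: sum_distrib_right)
    also have "\<dots> = 0" using c(2) by simp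
    finally show ?thesis .
  qed
  then show ?thesis using c(1) by blast
qed

end

section \<open>Generic points\<close>

text \<open>A set covered by finitely many real hypersurfaces. Being a nonzero polynomial is a
  condition on coefficients, and a family is kept in place of one polynomial so that unions need no
  products.\<close>

definition thin :: "'v set \<Rightarrow> ('v \<Rightarrow> real) set \<Rightarrow> bool" where
  "thin V X \<longleftrightarrow>
     (\<exists>\<C> :: (('v \<Rightarrow> nat) set \<times> (('v \<Rightarrow> nat) \<Rightarrow> real)) set. finite \<C> \<and>
       (\<forall>(E, c)\<in>\<C>. finite E \<and> (\<forall>e\<in>E. \<forall>v. v \<notin> V \<longrightarrow> e v = 0) \<and> (\<exists>e\<in>E. c e \<noteq> 0)) \<and>
       (\<forall>x\<in>X. \<exists>(E, c)\<in>\<C>. (\<Sum>e\<in>E. c e * monomial V e x) = 0))"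

lemma thin_subset: "thin V Y \<Longrightarrow> X \<subseteq> Y \<Longrightarrow> thin V X"
  unfolding thin_def by (meson subsetD)

lemma thin_zero_set:
  assumes "finite E" "\<And>e v. e \<in> E \<Longrightarrow> v \<notin> V \<Longrightarrow> e v = 0" "\<exists>e\<in>E. c e \<noteq> 0"
  shows "thin V {x. (\<Sum>e\<in>E. c e * monomial V e x) = 0}"
  unfolding thin_def using assms by (intro exI[of _ "{(E, c)}"]) auto

lemma thin_UN:
  assumes "finite T" "\<And>t. t \<in> T \<Longrightarrow> thin V (X t)"
  shows "thin V (\<Union>t\<in>T. X t)"
proof -
  from assms(2) have "\<forall>t\<in>T. \<exists>\<C>. finite \<C> \<and>
       (\<forall>(E, c)\<in>\<C>. finite E \<and> (\<forall>e\<in>E. \<forall>v. v \<notin> V \<longrightarrow> e v = 0) \<and> (\<exists>e\<in>E. c e \<noteq> 0)) \<and>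
       (\<forall>x\<in>X t. \<exists>(E, c)\<in>\<C>. (\<Sum>e\<in>E. c e * monomial V e x) = 0)"
    by (simp add: thin_def)
  from bchoice[OF this] obtain \<C> where \<C>: "\<forall>t\<in>T. finite (\<C> t) \<and>
       (\<forall>(E, c)\<in>\<C> t. finite E \<and> (\<forall>e\<in>E. \<forall>v. v \<notin> V \<longrightarrow> e v = 0) \<and> (\<exists>e\<in>E. c e \<noteq> 0)) \<and>
       (\<forall>x\<in>X t. \<exists>(E, c)\<in>\<C> t. (\<Sum>e\<in>E. c e * monomial V e x) = 0)" ..
  show ?thesis
    unfolding thin_def
  proof (intro exI[of _ "\<Union>t\<in>T. \<C> t"] conjI)
    show "finite (\<Union>t\<in>T. \<C> t)" using assms(1) \<C> by blast
  qed (use \<C> in fast)+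
qed

text \<open>Kronecker substitution: the weight \<open>m\<close> of the new variable exceeds all
  weighted sums of the old ones, so remainder and quotient modulo \<open>m\<close> recover both
  parts of the exponent.\<close>

lemma injective_weights:
  assumes "finite V" "finite E" "\<And>e v. e \<in> E \<Longrightarrow> v \<notin> V \<Longrightarrow> e v = 0"
  shows "\<exists>n :: 'v \<Rightarrow> nat. inj_on (\<lambda>e. \<Sum>v\<in>V. n v * e v) E"
  using assms
proof (induction V arbitrary: E rule: finite_induct)
  case empty
  then have "E \<subseteq> {\<lambda>_. 0}" by auto
  then show ?case by (auto intro: inj_on_subset)
next
  case (insert u V)
  let ?r = "\<lambda>e. e(u := 0 :: nat)"
  have "\<exists>n. inj_on (\<lambda>e. \<Sum>v\<in>V. n v * e v) (?r ` E)"
    by (rule insert.IH) (use insert.prems in auto)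
  then obtain n where n: "inj_on (\<lambda>e. \<Sum>v\<in>V. n v * e v) (?r ` E)" ..
  define s where "s e = (\<Sum>v\<in>V. n v * e v)" for e :: "'v \<Rightarrow> nat"
  have s_r: "s (?r e) = s e" for e
    unfolding s_def using insert.hyps by (intro sum.cong) auto
  obtain m where m: "\<And>e. e \<in> E \<Longrightarrow> s e < m"
    using finite_imageI[OF insert.prems(1), of s] finite_nat_set_iff_bounded by auto
  have total: "(\<Sum>v\<in>insert u V. (n(u := m)) v * e v) = s e + m * e u" for e
  proof -
    have "(\<Sum>v\<in>V. (n(u := m)) v * e v) = s e"
      unfolding s_def using insert.hyps by (intro sum.cong) auto
    then show ?thesis using insert.hyps by simp
  qed
  have "inj_on (\<lambda>e. s e + m * e u) E"
  proof (rule inj_onI)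
    fix e e' assume e: "e \<in> E" "e' \<in> E" "s e + m * e u = s e' + m * e' u"
    from m[OF e(1)] m[OF e(2)] have "s e = s e'"
      using arg_cong[OF e(3), of "\<lambda>x. x mod m"] by simp
    with e m[OF e(1)] have "e u = e' u" by simp
    moreover have "s (?r e) = s (?r e')" by (simp only: s_r \<open>s e = s e'\<close>)
    then have "?r e = ?r e'"
      by (intro inj_onD[OF n]) (use e in \<open>auto simp only: s_def\<close>)
    ultimately show "e = e'" by (metis fun_upd_triv fun_upd_upd)
  qed
  then show ?case using total by (intro exI[of _ "n(u := m)"]) simp
qed

text \<open>Thin sets have to be avoided with a margin, since an active penalty is later known to be
  only near its threshold, not on it.\<close>

lemma nonzero_polynomial_neighbourhood:
  assumes "(\<Sum>e\<in>E. c e * monomial V e x) \<noteq> 0"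
  shows "\<exists>\<rho>>0. \<forall>y. (\<forall>v\<in>V. \<bar>y v - x v\<bar> < \<rho>) \<longrightarrow> (\<Sum>e\<in>E. c e * monomial V e y) \<noteq> 0"
proof (rule ccontr)
  assume *: "\<not> ?thesis"
  have "\<exists>y. (\<forall>v\<in>V. \<bar>y v - x v\<bar> < inverse (real (Suc n))) \<and> (\<Sum>e\<in>E. c e * monomial V e y) = 0" for n
    using * by (metis inverse_positive_iff_positive of_nat_0_less_iff zero_less_Suc)
  then obtain y where y: "\<And>n v. v \<in> V \<Longrightarrow> \<bar>y n v - x v\<bar> < inverse (real (Suc n))"
    "\<And>n. (\<Sum>e\<in>E. c e * monomial V e (y n)) = 0"
    by metis
  have "(\<lambda>n. y n v) \<longlonglongrightarrow> x v" if "v \<in> V" for v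
  proof -
    have "(\<lambda>n. y n v - x v) \<longlonglongrightarrow> 0"
      by (rule tendsto_rabs_zero_cancel,
          rule tendsto_sandwich[OF _ _ tendsto_const LIMSEQ_inverse_real_of_nat])
        (intro always_eventually allI abs_ge_zero less_imp_le[OF y(1)[OF that]])+
    then show ?thesis by (rule LIM_zero_cancel)
  qed
  then have "(\<lambda>n. \<Sum>e\<in>E. c e * monomial V e (y n)) \<longlonglongrightarrow> (\<Sum>e\<in>E. c e * monomial V e x)"
    unfolding monomial_def by (intro tendsto_intros)
  then have "(\<lambda>n. 0) \<longlonglongrightarrow> (\<Sum>e\<in>E. c e * monomial V e x)" by (simp add: y(2))
  then show False using assms LIMSEQ_unique tendsto_const by blast
qed

text \<open>The point is found on the curve \<open>x v = t ^ n v\<close>, with weights \<open>n\<close> for which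
  distinct monomials restrict to distinct powers of \<open>t\<close>.\<close>

lemma thin_avoided_in_cube:
  fixes V :: "'v set"
  assumes "finite V" "thin V X"
  obtains x \<rho> where "\<And>v. 0 < x v \<and> x v \<le> 1" "\<rho> > 0"
    "\<And>y. \<forall>v\<in>V. \<bar>y v - x v\<bar> < \<rho> \<Longrightarrow> y \<notin> X"
proof -
  obtain \<C> :: "(('v \<Rightarrow> nat) set \<times> (('v \<Rightarrow> nat) \<Rightarrow> real)) set" where fin: "finite \<C>"
    and ball: "\<forall>(E, c)\<in>\<C>. finite E \<and> (\<forall>e\<in>E. \<forall>v. v \<notin> V \<longrightarrow> e v = 0) \<and> (\<exists>e\<in>E. c e \<noteq> 0)"
    and X: "\<forall>x\<in>X. \<exists>(E, c)\<in>\<C>. (\<Sum>e\<in>E. c e * monomial V e x) = 0"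
    using assms(2) unfolding thin_def by (elim exE conjE)
  have \<C>: "finite E" "\<And>e v. e \<in> E \<Longrightarrow> v \<notin> V \<Longrightarrow> e v = 0" "\<exists>e\<in>E. c e \<noteq> 0"
    if "(E, c) \<in> \<C>" for E c
    using bspec[OF ball that] by simp_all
  have "finite (\<Union>C\<in>\<C>. fst C)" using fin \<C>(1) by auto
  then have "\<exists>n. inj_on (\<lambda>e. \<Sum>v\<in>V. n v * e v) (\<Union>C\<in>\<C>. fst C)"
    by (rule injective_weights[OF assms(1)]) (use \<C>(2) in fastforce)
  then obtain n where n: "inj_on (\<lambda>e. \<Sum>v\<in>V. n v * e v) (\<Union>C\<in>\<C>. fst C)" ..
  define N where "N e = (\<Sum>v\<in>V. n v * e v)" for e :: "'v \<Rightarrow> nat"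
  define p where "p C = (\<Sum>e\<in>fst C. Polynomial.monom (snd C e) (N e))"
    for C :: "('v \<Rightarrow> nat) set \<times> (('v \<Rightarrow> nat) \<Rightarrow> real)"
  have poly_p: "poly (p (E, c)) t = (\<Sum>e\<in>E. c e * monomial V e (\<lambda>v. t ^ n v))" for E c t
    by (simp add: p_def poly_sum poly_monom monomial_def N_def power_sum power_mult)
  have "p C \<noteq> 0" if C: "C \<in> \<C>" for C
  proof -
    obtain E c where Ec: "C = (E, c)" by fastforce
    with \<C>(3) C obtain e0 where e0: "e0 \<in> E" "c e0 \<noteq> 0" by blast
    have "coeff (p C) (N e0) = (\<Sum>e\<in>E. if e = e0 then c e else 0)"
      unfolding p_def coeff_sum Ec fst_conv snd_conv coeff_monom
    proof (intro sum.cong refl)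
      fix e assume "e \<in> E"
      with e0(1) C Ec have "e \<in> (\<Union>C\<in>\<C>. fst C)" "e0 \<in> (\<Union>C\<in>\<C>. fst C)" by force+
      then have "N e = N e0 \<longleftrightarrow> e = e0" using n unfolding N_def by (auto dest: inj_onD)
      then show "(if N e = N e0 then c e else 0) = (if e = e0 then c e else 0)" by simp
    qed
    also have "\<dots> = c e0" using e0 \<C>(1) C Ec by simp
    finally show ?thesis using e0 by auto
  qed
  then have "finite (\<Union>C\<in>\<C>. {t. poly (p C) t = 0})" using fin by (auto intro: poly_roots_finite)
  then have "infinite ({0<..1} - (\<Union>C\<in>\<C>. {t. poly (p C) t = 0}))"
    by (intro Diff_infinite_finite) auto
  from infinite_imp_nonempty[OF this]
  obtain t where t': "t \<in> {0<..1} - (\<Union>C\<in>\<C>. {t. poly (p C) t = 0})" by blast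
  then have t: "0 < t" "t \<le> 1" and pt: "\<And>C. C \<in> \<C> \<Longrightarrow> poly (p C) t \<noteq> 0"
    by simp_all
  let ?x = "\<lambda>v. t ^ n v"
  have "\<forall>C\<in>\<C>. \<exists>\<rho>>0. \<forall>y. (\<forall>v\<in>V. \<bar>y v - ?x v\<bar> < \<rho>) \<longrightarrow>
      (\<Sum>e\<in>fst C. snd C e * monomial V e y) \<noteq> 0"
    using pt poly_p by (intro ballI nonzero_polynomial_neighbourhood) (metis prod.collapse)
  from bchoice[OF this] obtain r where r: "\<And>C. C \<in> \<C> \<Longrightarrow> r C > 0"
    "\<And>C y. C \<in> \<C> \<Longrightarrow> (\<forall>v\<in>V. \<bar>y v - ?x v\<bar> < r C) \<Longrightarrow> (\<Sum>e\<in>fst C. snd C e * monomial V e y) \<noteq> 0"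
    by blast
  \<comment> \<open>The extra \<open>1\<close> keeps the minimum defined when the family is
    empty.\<close>
  define \<rho> where "\<rho> = Min (insert 1 (r ` \<C>))"
  have "\<rho> > 0" using fin r(1) by (auto simp: \<rho>_def)
  have le: "\<rho> \<le> r C" if "C \<in> \<C>" for C using fin that by (simp add: \<rho>_def)
  have "y \<notin> X" if "\<forall>v\<in>V. \<bar>y v - ?x v\<bar> < \<rho>" for y
  proof
    assume "y \<in> X"
    with X obtain C where C: "C \<in> \<C>" "(\<Sum>e\<in>fst C. snd C e * monomial V e y) = 0" by fastforce
    have "\<forall>v\<in>V. \<bar>y v - ?x v\<bar> < r C" using that le[OF C(1)] by (meson less_le_trans)
    from r(2)[OF C(1) this] C(2) show False by simp
  qed
  with \<open>\<rho> > 0\<close> t show thesis by (intro that[of ?x \<rho>]) (auto simp: power_le_one)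
qed

section \<open>Generic fibres\<close>

text \<open>The right-hand side is the product (n+1)(n+2)...(n+k). Thus monomials of degree at most
  \<open>n\<close> in \<open>k\<close> quantities number at least \<open>n ^ k / k!\<close>.\<close>

lemma power_le_fact_times_binomial: "n ^ k \<le> fact k * ((n + k) choose k)"
proof (induction k)
  case (Suc k)
  have eq: "Suc k * (Suc (n + k) choose Suc k) = Suc (n + k) * ((n + k) choose k)"
    using Suc_times_binomial_eq[of "n + k" k] by (simp only: mult.commute)
  have "fact (Suc k) * ((n + Suc k) choose Suc k) = fact k * (Suc k * (Suc (n + k) choose Suc k))"
    by (simp only: fact_Suc of_nat_id add_Suc_right mult_ac)
  also have "\<dots> = (n + Suc k) * (fact k * ((n + k) choose k))"
    unfolding eq by (simp only: add_Suc_right mult_ac)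
  also have "\<dots> \<ge> n * n ^ k" using Suc.IH by (intro mult_mono) auto
  finally show ?case by simp
qed simp

lemma card_eq_sum_fibres:
  assumes "finite V"
  shows "card V = (\<Sum>i\<in>b ` V. card {v\<in>V. b v = i})"
  using sum.image_gen[OF assms, of "\<lambda>_. 1::nat" b] by simp

text \<open>The product in the hypothesis is the volume of a product of simplices, the leading
  coefficient of the count in \<open>n\<close>. The shift \<open>B\<close> and the block sizes
  contribute only lower-order terms, which vanish after division by
  \<open>n ^ card V\<close>.\<close>

lemma eventually_card_block_exponents_less:
  fixes D :: "'b \<Rightarrow> nat"
  assumes "finite V"
    and "(\<Prod>i\<in>b ` V. real (D i) ^ card {v\<in>V. b v = i} / fact (card {v\<in>V. b v = i})) < c"
  shows "\<forall>\<^sub>F n in sequentially.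
    real (card (block_exponents V b (\<lambda>i. n * D i + B))) < c * real n ^ card V"
proof -
  let ?k = "\<lambda>i. card {v\<in>V. b v = i}"
  let ?g = "\<lambda>n. \<Prod>i\<in>b ` V. (real (D i) + (B + ?k i) / real n) ^ ?k i / fact (?k i)"
  have "(\<lambda>n. \<Prod>i\<in>b ` V. (real (D i) + (B + ?k i) / real n) ^ ?k i / fact (?k i))
      \<longlonglongrightarrow> (\<Prod>i\<in>b ` V. (real (D i) + 0) ^ ?k i / fact (?k i))"
    by (intro tendsto_intros lim_const_over_n) auto
  then have "\<forall>\<^sub>F n in sequentially. ?g n < c"
    using assms(2) by (intro order_tendstoD(2)) auto
  moreover have "\<forall>\<^sub>F n in sequentially. n > (0::nat)" by (rule eventually_gt_at_top)
  ultimately show ?thesis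
  proof eventually_elim
    case (elim n)
    have "real (card (block_exponents V b (\<lambda>i. n * D i + B)))
        \<le> (\<Prod>i\<in>b ` V. real ((n * D i + B + ?k i) choose ?k i))"
      using finite_card_block_exponents[OF assms(1), of b "\<lambda>i. n * D i + B"]
      unfolding of_nat_prod[symmetric] of_nat_le_iff by blast
    also have "\<dots> \<le> (\<Prod>i\<in>b ` V. real n ^ ?k i * ((real (D i) + (B + ?k i) / real n) ^ ?k i / fact (?k i)))"
    proof (intro prod_mono conjI)
      fix i
      have "real ((n * D i + B + ?k i) choose ?k i) * fact (?k i) \<le> real (n * D i + B + ?k i) ^ ?k i"
        using of_nat_mono[OF binomial_fact_pow[of "n * D i + B + ?k i" "?k i"], where 'a = real]
        by simp
      also have "real (n * D i + B + ?k i) = real n * (real (D i) + (B + ?k i) / real n)"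
        using elim by (simp add: field_simps)
      finally show "real ((n * D i + B + ?k i) choose ?k i)
          \<le> real n ^ ?k i * ((real (D i) + (B + ?k i) / real n) ^ ?k i / fact (?k i))"
        by (simp add: power_mult_distrib pos_le_divide_eq)
    qed auto
    also have "\<dots> = real n ^ card V * ?g n"
      by (simp only: prod.distrib power_sum card_eq_sum_fibres[OF assms(1), of b])
    also have "\<dots> < real n ^ card V * c" using elim by simp
    finally show ?case by (simp add: mult.commute)
  qed
qed

text \<open>More polynomials than variables are algebraically dependent: their monomials of degree
  at most \<open>n\<close> grow like \<open>n ^ card T\<close>, the available exponents only like
  \<open>n ^ card V\<close>. The relation vanishes on the image, so a generic vector of thresholds
  is not attained on \<open>T\<close>.\<close>

lemma thin_polynomial_image:
  assumes "finite V" "finite J" "T \<subseteq> J" "card V < card T"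
    and "\<And>j. j \<in> T \<Longrightarrow> block_poly V b D (f j)"
  shows "thin J {y. \<exists>w. \<forall>j\<in>T. y j = f j w}"
proof -
  have finT: "finite T" using assms finite_subset by blast
  \<comment> \<open>Any \<open>c\<close> above the leading coefficient serves here, as the higher
    power of \<open>n\<close> decides the comparison.\<close>
  obtain c where c: "(\<Prod>i\<in>b ` V. real (D i) ^ card {v\<in>V. b v = i} / fact (card {v\<in>V. b v = i})) < c"
    using gt_ex by blast
  have "c > 0" by (rule le_less_trans[OF prod_nonneg c]) simp
  have "\<forall>\<^sub>F n in sequentially. real n > c * fact (card T)"
    using filterlim_real_sequentially by (simp add: filterlim_at_top_dense)
  from eventually_happens'[OF sequentially_bot eventually_conj[OF
        eventually_conj[OF this eventually_gt_at_top[of 0]]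
        eventually_card_block_exponents_less[OF assms(1) c, of 0]]]
  obtain n where n: "real n > c * fact (card T)" "n > 0"
    "real (card (block_exponents V b (\<lambda>i. n * D i + 0))) < c * real n ^ card V"
    by blast
  have "c * real n ^ card V * fact (card T) < real n * real n ^ card V"
    using n by (simp add: mult_ac)
  also have "\<dots> = real n ^ Suc (card V)" by simp
  also have "\<dots> \<le> real n ^ card T" using n assms(4) by (intro power_increasing) auto
  also have "\<dots> \<le> fact (card T) * real ((n + card T) choose card T)"
    using of_nat_mono[OF power_le_fact_times_binomial[of n "card T"], where 'a = real] by simp
  finally have "c * real n ^ card V < real (card (exponents T n))"
    using finite_card_exponents[OF finT, of n] by (simp add: mult.commute)
  with n(3) have less: "card (block_exponents V b (\<lambda>i. n * D i)) < card (exponents T n)"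
    by simp
  have "block_poly V b (\<lambda>i. n * D i) (\<lambda>w. \<Prod>j\<in>T. f j w ^ a j)" if "a \<in> exponents T n" for a
  proof (rule block_poly_mono[OF assms(1) block_poly_prod[OF assms(1)]])
    show "block_poly V b (\<lambda>i. a j * D i) (\<lambda>w. f j w ^ a j)" if "j \<in> T" for j
      using block_poly_power[OF assms(1) assms(5)[OF that]] .
    show "(\<Sum>j\<in>T. a j * D i) \<le> n * D i" for i
      using that by (simp add: exponents_def flip: sum_distrib_right)
  qed
  with block_polys_linearly_dependent[OF assms(1) _ less, of "\<lambda>a w. \<Prod>j\<in>T. f j w ^ a j"]
  have "\<exists>q. (\<exists>a\<in>exponents T n. q a \<noteq> 0) \<and>
      (\<forall>w. (\<Sum>a\<in>exponents T n. q a * (\<Prod>j\<in>T. f j w ^ a j)) = 0)"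
    using finite_card_exponents[OF finT] by blast
  then obtain q where q: "\<exists>a\<in>exponents T n. q a \<noteq> 0"
    "\<And>w. (\<Sum>a\<in>exponents T n. q a * (\<Prod>j\<in>T. f j w ^ a j)) = 0" by blast
  have "(\<Sum>a\<in>exponents T n. q a * monomial J a y) = 0" if y: "\<forall>j\<in>T. y j = f j w" for y w
  proof -
    have "monomial J a y = (\<Prod>j\<in>T. f j w ^ a j)" if "a \<in> exponents T n" for a
      unfolding monomial_def using assms(2,3) that y
      by (intro prod.mono_neutral_cong_right) (auto simp: exponents_def)
    then show ?thesis using q(2)[of w] by simp
  qed
  then have "{y. \<exists>w. \<forall>j\<in>T. y j = f j w}
      \<subseteq> {y. (\<Sum>a\<in>exponents T n. q a * monomial J a y) = 0}" by blast
  moreover have "thin J {y. (\<Sum>a\<in>exponents T n. q a * monomial J a y) = 0}"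
    using finite_card_exponents[OF finT] q(1) assms(3)
    by (intro thin_zero_set) (auto simp: exponents_def)
  ultimately show ?thesis using thin_subset by blast
qed

text \<open>Vectors on the moment curve: a nonzero vector is orthogonal to few of them.\<close>

lemma separating_linear_forms:
  fixes V :: "'v set"
  assumes "finite V"
  obtains g :: "nat \<Rightarrow> 'v \<Rightarrow> real" and m where
    "\<And>Z. card Z = Suc B \<Longrightarrow> (\<And>w v. w \<in> Z \<Longrightarrow> v \<notin> V \<Longrightarrow> w v = 0) \<Longrightarrow>
      \<exists>t<m. inj_on (\<lambda>w. \<Sum>v\<in>V. g t v * w v) Z"
proof -
  obtain h and K :: nat where h: "h ` V = {i. i < K}" "inj_on h V"
    using finite_imp_inj_to_nat_seg[OF assms] by metis
  define g where "g t v = real t ^ h v" for t v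
  have bad: "finite {t. (\<Sum>v\<in>V. g t v * z v) = 0} \<and> card {t. (\<Sum>v\<in>V. g t v * z v) = 0} \<le> K"
    if z: "v0 \<in> V" "z v0 \<noteq> 0" for z :: "'v \<Rightarrow> real" and v0
  proof -
    define p where "p = (\<Sum>v\<in>V. Polynomial.monom (z v) (h v))"
    have "coeff p (h v0) = (\<Sum>v\<in>V. if v = v0 then z v else 0)"
      unfolding p_def coeff_sum coeff_monom using z(1) h(2)
      by (intro sum.cong) (auto dest: inj_onD)
    then have "p \<noteq> 0" using z assms by auto
    moreover have "degree p \<le> K"
      unfolding p_def
    proof (rule degree_sum_le[OF assms])
      fix v assume "v \<in> V"
      then have "h v < K" using h(1) by blast
      then show "degree (Polynomial.monom (z v) (h v)) \<le> K"
        using degree_monom_le[of "z v" "h v"] by simp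
    qed
    ultimately have p: "finite {x. poly p x = 0}" "card {x. poly p x = 0} \<le> K"
      using poly_roots_finite card_poly_roots_bound order_trans by blast+
    have "real ` {t. (\<Sum>v\<in>V. g t v * z v) = 0} \<subseteq> {x. poly p x = 0}"
      by (auto simp: p_def poly_sum poly_monom g_def mult.commute)
    moreover have "inj_on real {t. (\<Sum>v\<in>V. g t v * z v) = 0}" by simp
    ultimately show ?thesis
      using p card_inj_on_le inj_on_finite order_trans by meson
  qed
  \<comment> \<open>There are at most \<open>Suc B * Suc B\<close> pairs of points, and each pair
    rules out at most \<open>K\<close> parameters. The bound does not depend on \<open>Z\<close>, so
    finitely many forms serve all fibres.\<close>
  define m where "m = Suc (Suc B * Suc B * K)"
  have "\<exists>t<m. inj_on (\<lambda>w. \<Sum>v\<in>V. g t v * w v) Z"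
    if Z: "card Z = Suc B" "\<And>w v. w \<in> Z \<Longrightarrow> v \<notin> V \<Longrightarrow> w v = 0" for Z
  proof (rule ccontr)
    assume *: "\<not> ?thesis"
    define Q where "Q = {(w, w'). w \<in> Z \<and> w' \<in> Z \<and> w \<noteq> w'}"
    define Bad where "Bad = (\<lambda>(w, w'). {t. (\<Sum>v\<in>V. g t v * (w v - w' v)) = 0})"
    have finZ: "finite Z" using Z(1) card.infinite by fastforce
    have QZ: "Q \<subseteq> Z \<times> Z" by (auto simp: Q_def)
    then have finQ: "finite Q" and "card Q \<le> Suc B * Suc B"
      using finZ finite_subset card_mono[of "Z \<times> Z" Q] Z(1) by (auto simp: card_cartesian_product)
    have Bad: "finite (Bad q) \<and> card (Bad q) \<le> K" if q: "q \<in> Q" for q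
    proof -
      obtain w w' where ww: "q = (w, w')" "w \<in> Z" "w' \<in> Z" "w \<noteq> w'"
        using q by (auto simp: Q_def)
      then obtain v where v: "w v \<noteq> w' v" by blast
      then have "v \<in> V" "w v - w' v \<noteq> 0" using Z(2)[OF ww(2), of v] Z(2)[OF ww(3), of v] by force+
      from bad[of v "\<lambda>v. w v - w' v", OF this] show ?thesis by (simp add: Bad_def ww)
    qed
    have "{..<m} \<subseteq> (\<Union>q\<in>Q. Bad q)"
    proof
      fix t assume "t \<in> {..<m}"
      with * have "\<not> inj_on (\<lambda>w. \<Sum>v\<in>V. g t v * w v) Z" by blast
      then show "t \<in> (\<Union>q\<in>Q. Bad q)"
        by (auto simp: inj_on_def Q_def Bad_def right_diff_distrib sum_subtractf)
    qed
    then have "m \<le> card (\<Union>q\<in>Q. Bad q)"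
      using card_mono[of "\<Union>q\<in>Q. Bad q" "{..<m}"] finQ Bad by auto
    also have "\<dots> \<le> (\<Sum>q\<in>Q. card (Bad q))" by (rule card_UN_le[OF finQ])
    also have "\<dots> \<le> card Q * K" using sum_bounded_above[of Q "\<lambda>q. card (Bad q)" K] Bad by simp
    also have "\<dots> \<le> Suc B * Suc B * K"
      by (rule mult_le_mono1[OF \<open>card Q \<le> Suc B * Suc B\<close>])
    finally show False by (simp add: m_def)
  qed
  then show thesis using that by blast
qed

text \<open>A linear form \<open>u\<close> is algebraic of degree at most \<open>B\<close> over the field generated by the
  \<open>P v\<close>: for large \<open>n\<close> there are more products of \<open>u ^ r\<close>, \<open>r \<le> B\<close>, with monomials of degree
  at most \<open>n\<close> in the \<open>P v\<close> than there are exponents available for them.  Over a point where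
  the resulting relation is nontrivial, \<open>u\<close> takes at most \<open>B\<close> values on the fibre.\<close>

lemma thin_large_fibres:
  fixes V :: "'v set" and b :: "'v \<Rightarrow> 'b"
  assumes V: "finite V" and P: "\<And>v. v \<in> V \<Longrightarrow> block_poly V b D (P v)"
    and B: "fact (card V) * (\<Prod>i\<in>b ` V. real (D i) ^ card {v\<in>V. b v = i}
        / fact (card {v\<in>V. b v = i})) < real (Suc B)"
  shows "thin V {p. \<exists>Z. card Z = Suc B \<and>
    (\<forall>w\<in>Z. (\<forall>v. v \<notin> V \<longrightarrow> w v = 0) \<and> (\<forall>v\<in>V. P v w = p v))}"
proof -
  obtain g :: "nat \<Rightarrow> 'v \<Rightarrow> real" and m where g:
    "\<And>Z. card Z = Suc B \<Longrightarrow> (\<And>w v. w \<in> Z \<Longrightarrow> v \<notin> V \<Longrightarrow> w v = 0) \<Longrightarrow>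
      \<exists>t<m. inj_on (\<lambda>w. \<Sum>v\<in>V. g t v * w v) Z"
    using separating_linear_forms[OF V] by metis
  define u where "u t w = (\<Sum>v\<in>V. g t v * w v)" for t w
  have "(\<Prod>i\<in>b ` V. real (D i) ^ card {v\<in>V. b v = i} / fact (card {v\<in>V. b v = i}))
      < real (Suc B) / fact (card V)"
    using B by (simp add: field_simps)
  from eventually_happens'[OF _ eventually_card_block_exponents_less[OF V this, of B]]
  obtain n where n: "real (card (block_exponents V b (\<lambda>i. n * D i + B)))
      < real (Suc B) / fact (card V) * real n ^ card V" by auto
  \<comment> \<open>The factor \<open>Suc B\<close> from the powers of the linear form is what beats
    the leading coefficient: \<open>card A\<close> is at least
    \<open>Suc B * n ^ card V / fact (card V)\<close>.\<close>
  define A where "A = exponents V n \<times> {..B}"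
  note fin_exp = finite_card_exponents[OF V, of n]
  have "real (Suc B) / fact (card V) * real n ^ card V
      \<le> real (Suc B) / fact (card V) * (fact (card V) * real ((n + card V) choose card V))"
    using of_nat_mono[OF power_le_fact_times_binomial[of n "card V"], where 'a = real]
    by (intro mult_left_mono) auto
  also have "\<dots> = real (card A)"
    using fin_exp by (simp add: A_def card_cartesian_product field_simps)
  finally have less: "card (block_exponents V b (\<lambda>i. n * D i + B)) < card A" using n by simp
  define F where "F t = (\<lambda>(a, r) w. (\<Prod>v\<in>V. P v w ^ a v) * u t w ^ r)" for t
  have F: "block_poly V b (\<lambda>i. n * D i + B) (F t x)" if x: "x \<in> A" for t x
  proof -
    obtain a r where ar: "x = (a, r)" "a \<in> exponents V n" "r \<le> B" using x by (auto simp: A_def)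
    have "block_poly V b (\<lambda>i. 1) (\<lambda>w. w v)" if "v \<in> V" for v
      by (rule block_poly_mono[OF V block_poly_var[OF V that]]) auto
    then have "block_poly V b (\<lambda>i. 1) (u t)"
      unfolding u_def by (intro block_poly_sum block_poly_cmult V)
    moreover have "block_poly V b (\<lambda>i. \<Sum>v\<in>V. a v * D i) (\<lambda>w. \<Prod>v\<in>V. P v w ^ a v)"
      by (intro block_poly_prod block_poly_power V P)
    ultimately
    have "block_poly V b (\<lambda>i. (\<Sum>v\<in>V. a v * D i) + r * 1) (F t x)"
      using block_poly_mult[OF V _ block_poly_power[OF V]] unfolding F_def ar(1) prod.case by blast
    then show ?thesis
      using ar by (elim block_poly_mono[OF V])
        (auto simp: exponents_def simp flip: sum_distrib_right intro!: add_mono)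
  qed
  have "\<forall>t. \<exists>c. (\<exists>x\<in>A. c x \<noteq> 0) \<and> (\<forall>w. (\<Sum>x\<in>A. c x * F t x w) = 0)"
    using block_polys_linearly_dependent[OF V _ less F] fin_exp by (simp add: A_def)
  then obtain c where c: "\<And>t. \<exists>x\<in>A. c t x \<noteq> 0" "\<And>t w. (\<Sum>x\<in>A. c t x * F t x w) = 0"
    by metis
  \<comment> \<open>Grouped by powers of \<open>u t\<close>, the relation has coefficients that are
    polynomials in the \<open>P v\<close>. At least one of them, of index \<open>r t\<close>, is
    nonzero as a polynomial; its zeros form the exceptional set for \<open>t\<close>.\<close>
  have "\<forall>t. \<exists>r\<le>B. \<exists>a\<in>exponents V n. c t (a, r) \<noteq> 0"
  proof
    fix t
    from c(1)[of t] obtain a r where "(a, r) \<in> A" "c t (a, r) \<noteq> 0" by force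
    then show "\<exists>r\<le>B. \<exists>a\<in>exponents V n. c t (a, r) \<noteq> 0" by (auto simp: A_def)
  qed
  then obtain r where r: "\<And>t. r t \<le> B" "\<And>t. \<exists>a\<in>exponents V n. c t (a, r t) \<noteq> 0" by metis
  define R where "R t i p = (\<Sum>a\<in>exponents V n. c t (a, i) * monomial V a p)" for t i p
  have thin: "thin V (\<Union>t<m. {p. R t (r t) p = 0})"
    unfolding R_def using fin_exp r(2)
    by (intro thin_UN thin_zero_set) (auto simp: exponents_def)
  have "p \<in> (\<Union>t<m. {p. R t (r t) p = 0})"
    if Z: "card Z = Suc B" "\<forall>w\<in>Z. (\<forall>v. v \<notin> V \<longrightarrow> w v = 0) \<and> (\<forall>v\<in>V. P v w = p v)" for p Z
  proof -
    obtain t where t: "t < m" "inj_on (u t) Z"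
      using g[OF Z(1)] Z(2) unfolding u_def by blast
    define Q where "Q = (\<Sum>i\<le>B. Polynomial.monom (R t i p) i)"
    have "poly Q (u t w) = 0" if w: "w \<in> Z" for w
    proof -
      have mon: "monomial V a p = (\<Prod>v\<in>V. P v w ^ a v)" for a
        unfolding monomial_def using Z(2) w by (intro prod.cong) auto
      have "poly Q (u t w) = (\<Sum>i\<le>B. \<Sum>a\<in>exponents V n. c t (a, i) * F t (a, i) w)"
        by (simp add: Q_def poly_sum poly_monom R_def F_def mon sum_distrib_right mult.assoc)
      also have "\<dots> = (\<Sum>x\<in>A. c t x * F t x w)"
        unfolding A_def by (subst sum.swap) (simp add: sum.cartesian_product)
      finally show ?thesis using c(2) by simp
    qed
    then have sub: "u t ` Z \<subseteq> {x. poly Q x = 0}" by auto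
    \<comment> \<open>\<open>Suc B\<close> distinct values of \<open>u t\<close> are roots of a
      polynomial of degree at most \<open>B\<close>, so all its coefficients vanish at
      \<open>p\<close>, including the one of index \<open>r t\<close>.\<close>
    have "Q = 0"
    proof (rule ccontr)
      assume Q: "Q \<noteq> 0"
      have "Suc B = card (u t ` Z)" using t(2) Z(1) by (simp add: card_image)
      also have "\<dots> \<le> card {x. poly Q x = 0}" by (rule card_mono[OF poly_roots_finite[OF Q] sub])
      also have "\<dots> \<le> degree Q" by (rule card_poly_roots_bound[OF Q])
      also have "\<dots> \<le> B"
        unfolding Q_def by (rule degree_sum_le) (auto intro: order_trans[OF degree_monom_le])
      finally show False by simp
    qed
    then have "coeff Q (r t) = 0" by simp
    then have "R t (r t) p = 0" using r(1)[of t] by (simp add: Q_def coeff_sum)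
    then show ?thesis using t by blast
  qed
  then show ?thesis by (intro thin_subset[OF thin]) blast
qed

section \<open>Sign patterns\<close>

lemma coercive_attains_minimum:
  fixes V :: "'v set" and h :: "('v \<Rightarrow> real) \<Rightarrow> real"
  assumes V: "finite V" and h: "continuous_on UNIV h" "\<And>w. 0 \<le> h w"
    and p: "\<And>v. v \<in> V \<Longrightarrow> 0 \<le> p v \<and> p v \<le> 1"
  obtains w where "\<forall>v. v \<notin> V \<longrightarrow> w v = 0"
    "\<And>w'. \<forall>v. v \<notin> V \<longrightarrow> w' v = 0 \<Longrightarrow>
      (\<Sum>v\<in>V. (w v - p v)\<^sup>2) / 2 + h w \<le> (\<Sum>v\<in>V. (w' v - p v)\<^sup>2) / 2 + h w'"
proof -
  define G where "G w = (\<Sum>v\<in>V. (w v - p v)\<^sup>2) / 2 + h w" for w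
  \<comment> \<open>With \<open>g\<close> the value of \<open>G\<close> at the origin, a point
    outside the box has a coordinate at distance at least \<open>1 + 2 * g\<close> from that of
    \<open>p\<close>. Half the square of this is at least \<open>g\<close>, so the point does not
    beat the origin.\<close>
  define R where "R = 2 + 2 * G (\<lambda>_. 0)"
  define K where "K = PiE UNIV (\<lambda>v. if v \<in> V then {-R..R} else {0})"
  have G_nonneg: "0 \<le> G w" for w using h(2) by (simp add: G_def sum_nonneg)
  have "compactin (product_topology (\<lambda>_. euclidean) UNIV) K"
    unfolding K_def compactin_PiE by auto
  then have "compact K" by (simp add: euclidean_product_topology)
  moreover have zero: "(\<lambda>_. 0) \<in> K"
    using G_nonneg[of "\<lambda>_. 0"] by (auto simp: K_def R_def)
  moreover have "continuous_on UNIV G"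
    unfolding G_def by (intro continuous_intros continuous_on_product_coordinates h) auto
  then have "continuous_on K G" by (rule continuous_on_subset) simp
  ultimately obtain w where w: "w \<in> K" "\<And>w'. w' \<in> K \<Longrightarrow> G w \<le> G w'"
    using continuous_attains_inf[of K G] by blast
  have "G w \<le> G w'" if w': "\<forall>v. v \<notin> V \<longrightarrow> w' v = 0" for w'
  proof (cases "w' \<in> K")
    case False
    then obtain v where v: "v \<in> V" "w' v < - R \<or> R < w' v"
      using w' by (auto simp: K_def PiE_iff not_le split: if_splits)
    define g where "g = G (\<lambda>_. 0)"
    have "g \<ge> 0" using G_nonneg by (simp add: g_def)
    have "\<bar>w' v - p v\<bar> \<ge> 1 + 2 * g" using v p[of v] by (auto simp: R_def g_def)
    then have "(1 + 2 * g)\<^sup>2 \<le> (w' v - p v)\<^sup>2" using \<open>g \<ge> 0\<close> by (simp add: abs_le_square_iff[symmetric])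
    moreover have "2 * g \<le> (1 + 2 * g)\<^sup>2" using \<open>g \<ge> 0\<close> by (simp add: power2_eq_square algebra_simps)
    moreover have "(w' v - p v)\<^sup>2 \<le> (\<Sum>v\<in>V. (w' v - p v)\<^sup>2)"
      using V v(1) by (intro member_le_sum) auto
    ultimately have "g \<le> G w'" using h(2)[of w'] by (simp add: G_def)
    then show ?thesis using w(2)[OF zero] by (simp add: g_def)
  qed (use w in blast)
  moreover have "w v = 0" if "v \<notin> V" for v
    using PiE_mem[OF w(1)[unfolded K_def], of v] that by simp
  ultimately show thesis using that[of w] unfolding G_def by blast
qed

text \<open>Squaring makes the penalty differentiable even at its threshold, so a minimiser there is
  still a critical point. The error of the linear approximation is at most \<open>h\<^sup>2\<close>
  on either side.\<close>

lemma has_real_derivative_square_positive_part: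
  "((\<lambda>x. (max 0 x)\<^sup>2) has_real_derivative 2 * max 0 x) (at (x::real))"
proof -
  define d where "d h = ((max 0 (x + h))\<^sup>2 - (max 0 x)\<^sup>2) / h" for h
  have bound: "\<bar>d h - 2 * max 0 x\<bar> \<le> \<bar>h\<bar>" if "h \<noteq> 0" for h
  proof -
    have "\<bar>(max 0 (x + h))\<^sup>2 - (max 0 x)\<^sup>2 - 2 * max 0 x * h\<bar> \<le> h\<^sup>2"
    proof (cases "x \<ge> 0"; cases "x + h \<ge> 0")
      assume "x \<ge> 0" "\<not> x + h \<ge> 0"
      then have "x * (x + 2 * h) \<le> 0" by (intro mult_nonneg_nonpos) auto
      moreover have "0 \<le> (x + h)\<^sup>2" by simp
      ultimately show ?thesis
        using \<open>x \<ge> 0\<close> \<open>\<not> x + h \<ge> 0\<close> by (simp add: max_def power2_eq_square algebra_simps abs_le_iff)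
    next
      assume "\<not> x \<ge> 0" "x + h \<ge> 0"
      then have "(x + h)\<^sup>2 \<le> h\<^sup>2" by (intro power_mono) auto
      then show ?thesis using \<open>\<not> x \<ge> 0\<close> \<open>x + h \<ge> 0\<close> by (simp add: max_def)
    qed (auto simp: max_def power2_eq_square algebra_simps)
    moreover have "d h * h = (max 0 (x + h))\<^sup>2 - (max 0 x)\<^sup>2"
      using that by (simp add: d_def)
    then have "(d h - 2 * max 0 x) * h = (max 0 (x + h))\<^sup>2 - (max 0 x)\<^sup>2 - 2 * max 0 x * h"
      by (simp only: left_diff_distrib)
    ultimately have "\<bar>d h - 2 * max 0 x\<bar> * \<bar>h\<bar> \<le> \<bar>h\<bar> * \<bar>h\<bar>"
      by (simp add: power2_eq_square flip: abs_mult)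
    then show ?thesis by (rule mult_right_le_imp_le) (use that in simp)
  qed
  have "((\<lambda>h. d h - 2 * max 0 x) \<longlongrightarrow> 0) (at 0)"
    by (rule tendsto_rabs_zero_cancel,
        rule tendsto_sandwich[OF _ _ tendsto_const tendsto_rabs_zero[OF tendsto_ident_at]])
      (auto simp: eventually_at_filter bound)
  then show ?thesis unfolding DERIV_def d_def by (rule LIM_zero_cancel)
qed

text \<open>Penalties at or above their threshold have zero derivative. Hence the equation depends
  on the minimiser only through polynomials and the active set, and \<open>p v\<close> stands alone
  on the right.\<close>

lemma penalised_minimum_critical:
  fixes V :: "'v set" and f :: "'s \<Rightarrow> ('v \<Rightarrow> real) \<Rightarrow> real"
  assumes V: "finite V" and J: "finite J" and v: "v \<in> V"
    and w: "\<forall>v. v \<notin> V \<longrightarrow> w v = 0"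
    and min: "\<And>w'. \<forall>v. v \<notin> V \<longrightarrow> w' v = 0 \<Longrightarrow>
      (\<Sum>v\<in>V. (w v - p v)\<^sup>2) / 2 + M / 2 * (\<Sum>s\<in>J. (max 0 (\<delta> s - f s w))\<^sup>2)
      \<le> (\<Sum>v\<in>V. (w' v - p v)\<^sup>2) / 2 + M / 2 * (\<Sum>s\<in>J. (max 0 (\<delta> s - f s w'))\<^sup>2)"
    and f': "\<And>s. s \<in> J \<Longrightarrow> ((\<lambda>t. f s (w(v := t))) has_real_derivative f' s) (at (w v))"
  shows "w v + M * (\<Sum>s\<in>{s\<in>J. f s w < \<delta> s}. (f s w - \<delta> s) * f' s) = p v"
proof -
  define G where "G t = (\<Sum>u\<in>V. ((w(v := t)) u - p u)\<^sup>2) / 2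
    + M / 2 * (\<Sum>s\<in>J. (max 0 (\<delta> s - f s (w(v := t))))\<^sup>2)" for t
  have dist: "((\<lambda>t. \<Sum>u\<in>V. ((w(v := t)) u - p u)\<^sup>2) has_real_derivative
      (\<Sum>u\<in>V. if u = v then 2 * (w v - p v) else 0)) (at (w v))"
  proof (rule DERIV_sum)
    show "((\<lambda>t. ((w(v := t)) u - p u)\<^sup>2) has_real_derivative
        (if u = v then 2 * (w v - p v) else 0)) (at (w v))" for u
      by (cases "u = v") (auto intro!: derivative_eq_intros)
  qed
  have pen: "((\<lambda>t. (max 0 (\<delta> s - f s (w(v := t))))\<^sup>2) has_real_derivative
      2 * max 0 (\<delta> s - f s w) * (- f' s)) (at (w v))" if "s \<in> J" for s
    using DERIV_chain2[OF has_real_derivative_square_positive_part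
        DERIV_diff[OF DERIV_const f'[OF that]], of "\<delta> s"] by simp
  have "(G has_real_derivative (\<Sum>u\<in>V. if u = v then 2 * (w v - p v) else 0) / 2
      + M / 2 * (\<Sum>s\<in>J. 2 * max 0 (\<delta> s - f s w) * (- f' s))) (at (w v))"
    unfolding G_def by (intro DERIV_add DERIV_cdivide DERIV_cmult DERIV_sum dist pen)
  moreover have "G (w v) \<le> G t" for t
  proof -
    have "\<forall>u. u \<notin> V \<longrightarrow> (w(v := t)) u = 0" using w v by auto
    from min[OF this] show ?thesis by (simp only: G_def fun_upd_triv)
  qed
  ultimately have "(\<Sum>u\<in>V. if u = v then 2 * (w v - p v) else 0) / 2
      + M / 2 * (\<Sum>s\<in>J. 2 * max 0 (\<delta> s - f s w) * (- f' s)) = 0"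
    by (intro DERIV_local_min[of G _ "w v" 1]) auto
  moreover have "(\<Sum>s\<in>J. 2 * max 0 (\<delta> s - f s w) * (- f' s))
      = 2 * (\<Sum>s\<in>{s\<in>J. f s w < \<delta> s}. (f s w - \<delta> s) * f' s)"
    unfolding sum_distrib_left using J
    by (intro sum.mono_neutral_cong_right) (auto simp: max_def algebra_simps)
  ultimately have "w v - p v + M * (\<Sum>s\<in>{s\<in>J. f s w < \<delta> s}. (f s w - \<delta> s) * f' s) = 0"
    using V v by (simp add: diff_divide_distrib)
  then show ?thesis by linarith
qed

section \<open>Injecting sign patterns into fibres of critical systems\<close>

lemma block_poly_scaled_shift:
  assumes "finite V" "block_poly V b D f"
  shows "block_poly V b D (\<lambda>w. f w / c + a)"
  using block_poly_add[OF assms(1) block_poly_cmult[OF assms, of "1 / c"] block_poly_const[OF assms(1)]]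
  by simp

text \<open>Membership in a pattern is the weak inequality \<open>0 \<le> \<phi>\<close>, so zeros
  are allowed. There are finitely many negative sample values; taking \<open>\<eta>\<close> at most
  half the least modulus among them, a shift by \<open>\<eta>\<close> opens a gap of the same size
  on both sides.\<close>

lemma strictly_separated_sample:
  fixes \<phi> :: "'x \<Rightarrow> 'w \<Rightarrow> real"
  assumes "finite S" "finite \<E>" "\<And>T x. T \<in> \<E> \<Longrightarrow> x \<in> S \<Longrightarrow> 0 \<le> \<phi> x (W T) \<longleftrightarrow> x \<in> T"
  obtains \<eta> where "\<eta> > 0"
    "\<And>T x. T \<in> \<E> \<Longrightarrow> x \<in> S \<Longrightarrow> x \<in> T \<Longrightarrow> 1 \<le> \<phi> x (W T) / \<eta> + 1"
    "\<And>T x. T \<in> \<E> \<Longrightarrow> x \<in> S \<Longrightarrow> x \<notin> T \<Longrightarrow> \<phi> x (W T) / \<eta> + 1 \<le> -1"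
proof -
  define N where "N = {(T, x). T \<in> \<E> \<and> x \<in> S \<and> x \<notin> T}"
  define \<eta> where "\<eta> = Min (insert 1 ((\<lambda>(T, x). - \<phi> x (W T) / 2) ` N))"
  have "N \<subseteq> \<E> \<times> S" by (auto simp: N_def)
  then have fin: "finite N" using assms(1,2) finite_subset by blast
  have neg: "\<phi> x (W T) < 0" if "(T, x) \<in> N" for T x
    using that assms(3)[of T x] by (auto simp: N_def not_le[symmetric])
  have "\<eta> > 0" using fin neg by (auto simp: \<eta>_def)
  moreover have "\<phi> x (W T) / \<eta> + 1 \<le> -1" if "T \<in> \<E>" "x \<in> S" "x \<notin> T" for T x
  proof -
    have "(T, x) \<in> N" using that by (simp add: N_def)
    then have "\<eta> \<le> - \<phi> x (W T) / 2"
      unfolding \<eta>_def using fin by (intro Min_le) force+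
    then have "\<phi> x (W T) / \<eta> \<le> -2" using \<open>\<eta> > 0\<close> by (simp add: field_simps)
    then show ?thesis by simp
  qed
  moreover have "1 \<le> \<phi> x (W T) / \<eta> + 1" if "T \<in> \<E>" "x \<in> S" "x \<in> T" for T x
    using assms(3)[of T x] that \<open>\<eta> > 0\<close> by simp
  ultimately show thesis using that by blast
qed

lemma card_small_subsets_le:
  assumes "finite J"
  shows "finite {A. A \<subseteq> J \<and> card A \<le> k} \<and> card {A. A \<subseteq> J \<and> card A \<le> k} \<le> (\<Sum>s\<le>k. card J choose s)"
proof -
  have eq: "{A. A \<subseteq> J \<and> card A \<le> k} = (\<Union>s\<le>k. {A. A \<subseteq> J \<and> card A = s})" by auto
  have "card {A. A \<subseteq> J \<and> card A \<le> k} \<le> (\<Sum>s\<le>k. card {A. A \<subseteq> J \<and> card A = s})"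
    unfolding eq by (rule card_UN_le) simp
  then show ?thesis using assms by (simp add: n_subsets)
qed

lemma card_sign_patterns_le:
  fixes V :: "'v set" and bl :: "'v \<Rightarrow> 'b" and S :: "'x set" and \<phi> :: "'x \<Rightarrow> ('v \<Rightarrow> real) \<Rightarrow> real"
  assumes V: "finite V" and S: "finite S"
    and \<phi>: "\<And>x. x \<in> S \<Longrightarrow> block_poly V bl D (\<phi> x)"
    and D: "\<And>i. i \<in> bl ` V \<Longrightarrow> 1 \<le> D i"
    and \<E>: "\<E> \<subseteq> Pow S" "\<And>T. T \<in> \<E> \<Longrightarrow> \<exists>w. \<forall>x\<in>S. 0 \<le> \<phi> x w \<longleftrightarrow> x \<in> T"
    and B: "fact (card V) * (\<Prod>i\<in>bl ` V. real (2 * D i) ^ card {v\<in>V. bl v = i}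
        / fact (card {v\<in>V. bl v = i})) < real (Suc B)"
  shows "card \<E> \<le> B * (\<Sum>s\<le>card V. 2 * card S choose s)"
proof -
  have fin\<E>: "finite \<E>" using \<E>(1) S finite_subset by blast
  have "\<exists>w. (\<forall>v. v \<notin> V \<longrightarrow> w v = 0) \<and> (\<forall>x\<in>S. 0 \<le> \<phi> x w \<longleftrightarrow> x \<in> T)" if T: "T \<in> \<E>" for T
  proof -
    obtain w where w: "\<forall>x\<in>S. 0 \<le> \<phi> x w \<longleftrightarrow> x \<in> T" using \<E>(2)[OF T] by blast
    let ?w = "\<lambda>v. if v \<in> V then w v else 0"
    have "\<phi> x ?w = \<phi> x w" if "x \<in> S" for x by (rule block_poly_cong[OF V \<phi>[OF that]]) simp
    then show ?thesis using w by (intro exI[of _ ?w]) simp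
  qed
  then obtain W where W: "\<And>T v. T \<in> \<E> \<Longrightarrow> v \<notin> V \<Longrightarrow> W T v = 0"
    "\<And>T x. T \<in> \<E> \<Longrightarrow> x \<in> S \<Longrightarrow> 0 \<le> \<phi> x (W T) \<longleftrightarrow> x \<in> T"
    by metis
  obtain \<eta> where \<eta>:
    "\<And>T x. T \<in> \<E> \<Longrightarrow> x \<in> S \<Longrightarrow> x \<in> T \<Longrightarrow> 1 \<le> \<phi> x (W T) / \<eta> + 1"
    "\<And>T x. T \<in> \<E> \<Longrightarrow> x \<in> S \<Longrightarrow> x \<notin> T \<Longrightarrow> \<phi> x (W T) / \<eta> + 1 \<le> -1"
    using strictly_separated_sample[OF S fin\<E> W(2)] by metis
  define g where "g x w = \<phi> x w / \<eta> + 1" for x w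
  \<comment> \<open>The Boolean selects \<open>g\<close> or its negative. A pattern uses only one of
    the two at each input, but thresholds are chosen for both.\<close>
  define J where "J = S \<times> (UNIV :: bool set)"
  define f where "f s w = (if snd s then g (fst s) w else - g (fst s) w)" for s w
  have J: "finite J" "card J = 2 * card S"
    using S by (simp_all add: J_def card_cartesian_product)
  have f: "block_poly V bl D (f s)" if "s \<in> J" for s
  proof -
    have "block_poly V bl D (g (fst s))"
      unfolding g_def using that by (intro block_poly_scaled_shift V \<phi>) (auto simp: J_def)
    moreover have "f s = (if snd s then g (fst s) else (\<lambda>w. - g (fst s) w))"
      by (auto simp: f_def)
    ultimately show ?thesis
      using block_poly_cmult[OF V, of bl D "g (fst s)" "-1"] by simp
  qed
  have "\<exists>f'. block_poly V bl D f' \<and>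
      (\<forall>w. ((\<lambda>t. f s (w(v := t))) has_real_derivative f' w) (at (w v)))"
    if "s \<in> J" "v \<in> V" for s v
    using block_poly_has_partial_derivative[OF V f[OF that(1)] that(2)] by metis
  then obtain f' where f': "\<And>s v. s \<in> J \<Longrightarrow> v \<in> V \<Longrightarrow> block_poly V bl D (f' s v)"
    "\<And>s v w. s \<in> J \<Longrightarrow> v \<in> V \<Longrightarrow>
      ((\<lambda>t. f s (w(v := t))) has_real_derivative f' s v w) (at (w v))"
    by metis

  have "thin J (\<Union>A\<in>{A. A \<subseteq> J \<and> card V < card A}. {y. \<exists>w. \<forall>s\<in>A. y s = f s w})"
  proof (rule thin_UN)
    fix A assume "A \<in> {A. A \<subseteq> J \<and> card V < card A}"
    then have A: "A \<subseteq> J" "card V < card A" by auto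
    show "thin J {y. \<exists>w. \<forall>s\<in>A. y s = f s w}"
      by (rule thin_polynomial_image[OF V J(1) A f]) (use A in auto)
  qed (use J(1) in simp)
  from thin_avoided_in_cube[OF J(1) this]
  obtain \<delta> \<rho>' where \<delta>: "\<And>s. 0 < \<delta> s \<and> \<delta> s \<le> 1" and "\<rho>' > 0"
    and \<rho>': "\<And>y. \<forall>s\<in>J. \<bar>y s - \<delta> s\<bar> < \<rho>' \<Longrightarrow>
      y \<notin> (\<Union>A\<in>{A. A \<subseteq> J \<and> card V < card A}. {y. \<exists>w. \<forall>s\<in>A. y s = f s w})"
    by blast
  \<comment> \<open>Besides the genericity margin, \<open>\<rho>\<close> is kept below every
    threshold, so that a value within \<open>\<rho>\<close> of its threshold is positive.\<close>
  define \<rho> where "\<rho> = Min (insert \<rho>' (\<delta> ` J))"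
  have "\<rho> > 0" "\<rho> \<le> \<rho>'" and \<rho>_le: "\<And>s. s \<in> J \<Longrightarrow> \<rho> \<le> \<delta> s"
    using J(1) \<delta> \<open>\<rho>' > 0\<close> by (auto simp: \<rho>_def)
  have few: "card A \<le> card V" if "A \<subseteq> J" "\<And>s. s \<in> A \<Longrightarrow> \<bar>f s w - \<delta> s\<bar> < \<rho>" for A w
  proof (rule ccontr)
    assume "\<not> card A \<le> card V"
    \<comment> \<open>Moving the thresholds in \<open>A\<close> onto the actual values changes them
      by less than the margin, yet lands in the thin set.\<close>
    then have "(\<lambda>s. if s \<in> A then f s w else \<delta> s)
        \<in> (\<Union>A\<in>{A. A \<subseteq> J \<and> card V < card A}. {y. \<exists>w. \<forall>s\<in>A. y s = f s w})"
      using that(1) by (intro UN_I[of A]) auto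
    moreover have "(\<lambda>s. if s \<in> A then f s w else \<delta> s)
        \<notin> (\<Union>A\<in>{A. A \<subseteq> J \<and> card V < card A}. {y. \<exists>w. \<forall>s\<in>A. y s = f s w})"
      using that(2) \<open>\<rho> > 0\<close> \<open>\<rho> \<le> \<rho>'\<close> by (intro \<rho>') (auto intro: less_le_trans)
    ultimately show False by contradiction
  qed

  \<comment> \<open>\<open>C\<close> bounds the squared distance from each sample weight to any
    point of the unit cube, so \<open>M\<close> is fixed before \<open>p\<close>. A penalty cost of
    at most \<open>C / 2\<close> then forces \<open>(f s w - \<delta> s)\<^sup>2 \<le> C / (C + 1) *
    \<rho>\<^sup>2\<close>, which is strictly below \<open>\<rho>\<^sup>2\<close>.\<close>
  define C where "C = (\<Sum>T\<in>\<E>. \<Sum>v\<in>V. (\<bar>W T v\<bar> + 1)\<^sup>2)"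
  define M where "M = (C + 1) / \<rho>\<^sup>2"
  have "C \<ge> 0" by (simp add: C_def sum_nonneg)
  then have "M > 0" using \<open>\<rho> > 0\<close> by (simp add: M_def)
  define P where "P A v w = w v + M * (\<Sum>s\<in>A. (f s w - \<delta> s) * f' s v w)" for A v w
  define \<A> where "\<A> = {A. A \<subseteq> J \<and> card A \<le> card V}"
  have \<A>: "finite \<A>" "card \<A> \<le> (\<Sum>s\<le>card V. 2 * card S choose s)"
    using card_small_subsets_le[OF J(1), of "card V"] by (simp_all add: \<A>_def J(2))
  have P: "block_poly V bl (\<lambda>i. 2 * D i) (P A v)" if "A \<in> \<A>" "v \<in> V" for A v
    unfolding P_def
  proof (intro block_poly_add block_poly_cmult block_poly_sum V)
    show "block_poly V bl (\<lambda>i. 2 * D i) (\<lambda>w. w v)"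
      using D by (intro block_poly_mono[OF V block_poly_var[OF V that(2)]]) force
    fix s assume "s \<in> A"
    then have s: "s \<in> J" using that(1) by (auto simp: \<A>_def)
    have "block_poly V bl D (\<lambda>w. f s w - \<delta> s)"
      using block_poly_scaled_shift[OF V f[OF s], of 1 "- \<delta> s"] by simp
    from block_poly_mult[OF V this f'(1)[OF s that(2)]]
    show "block_poly V bl (\<lambda>i. 2 * D i) (\<lambda>w. (f s w - \<delta> s) * f' s v w)"
      by (simp add: mult_2)
  qed
  define Fib where "Fib A p = {w. (\<forall>v. v \<notin> V \<longrightarrow> w v = 0) \<and> (\<forall>v\<in>V. P A v w = p v)}" for A p
  have "thin V (\<Union>A\<in>\<A>. {p. \<exists>Z. card Z = Suc B \<and>
      (\<forall>w\<in>Z. (\<forall>v. v \<notin> V \<longrightarrow> w v = 0) \<and> (\<forall>v\<in>V. P A v w = p v))})"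
    by (intro thin_UN \<A> thin_large_fibres[OF V P B])
  from thin_avoided_in_cube[OF V this]
  obtain p \<rho>'' where p: "\<And>v. 0 < p v \<and> p v \<le> 1" and "\<rho>'' > 0"
    and *: "\<And>y. \<forall>v\<in>V. \<bar>y v - p v\<bar> < \<rho>'' \<Longrightarrow> y \<notin> (\<Union>A\<in>\<A>. {p. \<exists>Z. card Z = Suc B \<and>
      (\<forall>w\<in>Z. (\<forall>v. v \<notin> V \<longrightarrow> w v = 0) \<and> (\<forall>v\<in>V. P A v w = p v))})"
    by blast
  have Fib: "finite (Fib A p) \<and> card (Fib A p) \<le> B" if "A \<in> \<A>" for A
  proof (rule finite_if_finite_subsets_card_bdd)
    fix G assume G: "G \<subseteq> Fib A p" "finite G"
    show "card G \<le> B"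
    proof (rule ccontr)
      assume "\<not> card G \<le> B"
      then obtain Z where Z: "Z \<subseteq> G" "card Z = Suc B"
        using obtain_subset_with_card_n[of "Suc B" G] by auto
      with G(1) have "p \<in> (\<Union>A\<in>\<A>. {p. \<exists>Z. card Z = Suc B \<and>
          (\<forall>w\<in>Z. (\<forall>v. v \<notin> V \<longrightarrow> w v = 0) \<and> (\<forall>v\<in>V. P A v w = p v))})"
        unfolding Fib_def by (intro UN_I[OF that]) blast
      moreover have "\<forall>v\<in>V. \<bar>p v - p v\<bar> < \<rho>''" using \<open>\<rho>'' > 0\<close> by simp
      ultimately show False using * by blast
    qed
  qed

  have "\<exists>A w. A \<in> \<A> \<and> w \<in> Fib A p \<and> T = {x\<in>S. 0 < g x w}" if T: "T \<in> \<E>" for T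
  proof -
    define JT where "JT = (\<lambda>x. (x, x \<in> T)) ` S"
    have JT: "finite JT" "JT \<subseteq> J" using S by (auto simp: JT_def J_def)
    define h where "h w = M / 2 * (\<Sum>s\<in>JT. (max 0 (\<delta> s - f s w))\<^sup>2)" for w
    have "continuous_on UNIV h"
      unfolding h_def using JT(2)
      by (intro continuous_intros block_poly_continuous[OF V f]) auto
    moreover have h_nonneg: "0 \<le> h w" for w
      using \<open>M > 0\<close> by (simp add: h_def sum_nonneg)
    moreover have "0 \<le> p v \<and> p v \<le> 1" for v using p[of v] by simp
    ultimately obtain w where w: "\<forall>v. v \<notin> V \<longrightarrow> w v = 0"
      and min: "\<And>w'. \<forall>v. v \<notin> V \<longrightarrow> w' v = 0 \<Longrightarrow>
        (\<Sum>v\<in>V. (w v - p v)\<^sup>2) / 2 + h w \<le> (\<Sum>v\<in>V. (w' v - p v)\<^sup>2) / 2 + h w'"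
      using coercive_attains_minimum[OF V, of h p] by blast
    define A where "A = {s\<in>JT. f s w < \<delta> s}"
    \<comment> \<open>The sample weight clears the level \<open>1\<close>, hence every threshold. It
      pays no penalty and serves as the competitor that bounds the minimum.\<close>
    have "f s (W T) \<ge> \<delta> s" if "s \<in> JT" for s
      using that \<eta>[OF T] order_trans[OF conjunct2[OF \<delta>]] by (fastforce simp: JT_def f_def g_def)
    then have "max 0 (\<delta> s - f s (W T)) = 0" if "s \<in> JT" for s using that by simp
    then have "h (W T) = 0" by (simp add: h_def)
    have "h w \<le> (\<Sum>v\<in>V. (w v - p v)\<^sup>2) / 2 + h w" by (simp add: sum_nonneg)
    also have "\<dots> \<le> (\<Sum>v\<in>V. (W T v - p v)\<^sup>2) / 2"
      using min[of "W T"] W(1)[OF T] \<open>h (W T) = 0\<close> by simp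
    also have "\<dots> \<le> (\<Sum>v\<in>V. (\<bar>W T v\<bar> + 1)\<^sup>2) / 2"
    proof (intro divide_right_mono sum_mono)
      fix v
      have "\<bar>W T v - p v\<bar> \<le> \<bar>\<bar>W T v\<bar> + 1\<bar>" using p[of v] by linarith
      then show "(W T v - p v)\<^sup>2 \<le> (\<bar>W T v\<bar> + 1)\<^sup>2" by (simp only: abs_le_square_iff)
    qed simp
    also have "\<dots> \<le> C / 2"
      unfolding C_def using T fin\<E>
      by (intro divide_right_mono member_le_sum[where f = "\<lambda>T. \<Sum>v\<in>V. (\<bar>W T v\<bar> + 1)\<^sup>2"])
        (auto simp: sum_nonneg)
    finally have hC: "h w \<le> C / 2" .
    have close: "\<bar>f s w - \<delta> s\<bar> < \<rho>" if "s \<in> A" for s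
    proof -
      have s: "s \<in> JT" "f s w < \<delta> s" using that by (auto simp: A_def)
      have "(f s w - \<delta> s)\<^sup>2 = (max 0 (\<delta> s - f s w))\<^sup>2"
        using s by (simp add: max_def power2_commute)
      also have "\<dots> \<le> (\<Sum>s\<in>JT. (max 0 (\<delta> s - f s w))\<^sup>2)"
        using s JT(1) by (intro member_le_sum[where f = "\<lambda>s. (max 0 (\<delta> s - f s w))\<^sup>2"]) auto
      finally have "M / 2 * (f s w - \<delta> s)\<^sup>2 \<le> C / 2"
        using hC \<open>M > 0\<close> unfolding h_def by (meson mult_left_mono order_trans half_gt_zero less_imp_le)
      then have "(C + 1) * (f s w - \<delta> s)\<^sup>2 \<le> C * \<rho>\<^sup>2"
        using \<open>\<rho> > 0\<close> by (simp add: M_def field_simps)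
      also have "\<dots> < (C + 1) * \<rho>\<^sup>2" using \<open>\<rho> > 0\<close> by simp
      finally have "(f s w - \<delta> s)\<^sup>2 < \<rho>\<^sup>2" using \<open>C \<ge> 0\<close> by simp
      then have "\<bar>f s w - \<delta> s\<bar>\<^sup>2 < \<rho>\<^sup>2" by simp
      then show ?thesis by (rule power2_less_imp_less) (use \<open>\<rho> > 0\<close> in simp)
    qed
    have "A \<subseteq> J" using JT(2) by (auto simp: A_def)
    then have "A \<in> \<A>" using few[of A w] close by (simp add: \<A>_def)
    moreover have "w \<in> Fib A p"
      using w penalised_minimum_critical[OF V JT(1) _ w min[unfolded h_def], of _ "\<lambda>s. f' s _ w"] f'(2) JT(2)
      unfolding Fib_def P_def A_def by blast
    moreover have "T = {x\<in>S. 0 < g x w}"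
    proof -
      \<comment> \<open>Active constraints are within \<open>\<rho> \<le> \<delta> s\<close> of
        \<open>\<delta> s\<close>, inactive ones are at least \<open>\<delta> s\<close>. Either way
        the sign demanded by \<open>T\<close> is strict at \<open>w\<close>, so \<open>w\<close>
        alone reveals \<open>T\<close>.\<close>
      have "0 < f s w" if s: "s \<in> JT" for s
      proof (cases "s \<in> A")
        case True
        then have "\<bar>f s w - \<delta> s\<bar> < \<delta> s" using close \<rho>_le s JT(2) by (meson less_le_trans subsetD)
        then show ?thesis by linarith
      next
        case False
        then show ?thesis using s \<delta>[of s] by (auto simp: A_def)
      qed
      then have "0 < f (x, x \<in> T) w" if "x \<in> S" for x using that by (simp add: JT_def)
      then have "x \<in> T \<longleftrightarrow> 0 < g x w" if "x \<in> S" for x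
        using that by (fastforce simp: f_def split: if_splits)
      then show ?thesis using T \<E>(1) by blast
    qed
    ultimately show ?thesis by blast
  qed
  then have "\<E> \<subseteq> (\<lambda>(A, w). {x\<in>S. 0 < g x w}) ` (SIGMA A:\<A>. Fib A p)" by force
  moreover have finite_Sigma: "finite (SIGMA A:\<A>. Fib A p)" using \<A>(1) Fib by auto
  ultimately have "card \<E> \<le> card (SIGMA A:\<A>. Fib A p)" by (rule surj_card_le[rotated])
  also have "\<dots> = (\<Sum>A\<in>\<A>. card (Fib A p))" using \<A>(1) Fib by simp
  also have "\<dots> \<le> card \<A> * B" using sum_bounded_above[of \<A> "\<lambda>A. card (Fib A p)" B] Fib by simp
  also have "\<dots> \<le> B * (\<Sum>s\<le>card V. 2 * card S choose s)" using \<A>(2) by simp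
  finally show ?thesis .
qed

section \<open>The sample size\<close>

text \<open>Weighting the terms by powers of \<open>x = k / n \<le> 1\<close> costs at most the
  factor \<open>x ^ k\<close> and completes the sum to
  \<open>(1 + x) ^ n \<le> exp k\<close>.\<close>

lemma sum_binomial_le_exp_power:
  assumes "1 \<le> k" "k \<le> n"
  shows "(\<Sum>s\<le>k. real (n choose s)) \<le> (exp 1 * real n / real k) ^ k"
proof -
  define x where "x = real k / real n"
  have x: "0 < x" "x \<le> 1" using assms by (auto simp: x_def)
  have "(\<Sum>s\<le>k. real (n choose s)) * x ^ k \<le> (\<Sum>s\<le>k. real (n choose s) * x ^ s)"
    unfolding sum_distrib_right using x by (intro sum_mono mult_left_mono power_decreasing) auto
  also have "\<dots> \<le> (\<Sum>s\<le>n. real (n choose s) * x ^ s)"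
    using assms x by (intro sum_mono2) auto
  also have "\<dots> = (x + 1) ^ n" by (simp add: binomial_ring)
  also have "x + 1 \<le> exp x" using exp_ge_add_one_self[of x] by linarith
  then have "(x + 1) ^ n \<le> exp x ^ n" using x by (intro power_mono) auto
  also have "\<dots> = exp 1 ^ k" using assms by (simp add: x_def flip: exp_of_nat_mult)
  finally have "(\<Sum>s\<le>k. real (n choose s)) \<le> exp 1 ^ k / x ^ k"
    using x by (simp add: pos_le_divide_eq)
  also have "\<dots> = (exp 1 * real n / real k) ^ k" by (simp add: x_def power_mult_distrib power_divide)
  finally show ?thesis .
qed

text \<open>The left-hand side is one term of the multinomial expansion of the right-hand side. The
  induction splits off one block and keeps a single term of the binomial expansion.\<close>

lemma fact_sum_le_power_sum:
  fixes k :: "'i \<Rightarrow> nat"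
  assumes "finite I"
  shows "fact (sum k I) * (\<Prod>i\<in>I. real (k i) ^ k i / fact (k i)) \<le> real (sum k I) ^ sum k I"
  using assms
proof (induction I rule: finite_induct)
  case (insert j I)
  let ?s = "sum k I" and ?a = "k j"
  let ?P = "\<Prod>i\<in>I. real (k i) ^ k i / fact (k i)"
  have choose: "real ((?a + ?s) choose ?a) = fact (?a + ?s) / (fact ?a * fact ?s)"
    by (simp add: binomial_fact)
  have "fact (?a + ?s) * (real ?a ^ ?a / fact ?a * ?P)
      = real ((?a + ?s) choose ?a) * real ?a ^ ?a * (fact ?s * ?P)"
    by (simp add: choose)
  also have "\<dots> \<le> real ((?a + ?s) choose ?a) * real ?a ^ ?a * real ?s ^ ?s"
    using insert.IH by (intro mult_left_mono) auto
  also have "\<dots> \<le> (\<Sum>r\<le>?a + ?s. real ((?a + ?s) choose r) * real ?a ^ r * real ?s ^ (?a + ?s - r))"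
  proof -
    define t where "t r = real ((?a + ?s) choose r) * real ?a ^ r * real ?s ^ (?a + ?s - r)" for r
    have "t ?a \<le> sum t {..?a + ?s}" by (rule member_le_sum) (auto simp: t_def simp del: of_nat_sum)
    then show ?thesis by (simp only: t_def[abs_def] diff_add_inverse)
  qed
  also have "\<dots> = (real ?a + real ?s) ^ (?a + ?s)" by (rule binomial_ring[symmetric])
  finally show ?case using insert.hyps by simp
qed simp

text \<open>Equality holds at 4, and beyond it the slope of the logarithm is at most
  \<open>1 / 2\<close>, because \<open>ln 2 \<ge> 1 / 2\<close>.\<close>

lemma log2_le_half:
  assumes "4 \<le> x"
  shows "log 2 x \<le> x / 2"
proof -
  have "ln x = ln 4 + ln (x / 4)" using assms by (simp add: ln_div)
  also have "\<dots> \<le> 2 * ln 2 + (x / 4 - 1)"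
    using ln_le_minus_one[of "x / 4"] ln_realpow[of 2 2] assms by simp
  also have "ln (1 / 2 :: real) \<le> 1 / 2 - 1" by (rule ln_le_minus_one) simp
  then have "1 / 2 \<le> ln (2::real)" by (simp add: ln_div)
  then have "(x - 4) * (1 / 2) \<le> (x - 4) * ln (2::real)"
    using assms by (intro mult_left_mono) auto
  then have "2 * ln 2 + (x / 4 - 1) \<le> x / 2 * ln 2" by (simp add: algebra_simps)
  finally show ?thesis by (simp add: log_def field_simps)
qed

text \<open>With \<open>A\<close> the sum on the right and \<open>x = m / K\<close>, logarithms give
  \<open>m \<le> A + K * log 2 x\<close>. For \<open>x \<ge> 4\<close> the last term is at most
  \<open>m / 2\<close>, which is absorbed at the price of the factor 2; for smaller \<open>x\<close>
  the estimate \<open>2 * K \<le> A\<close> suffices.\<close>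

lemma sample_size_bound:
  fixes k D :: "'i \<Rightarrow> nat" and I :: "'i set"
  defines "K \<equiv> sum k I"
  assumes I: "finite I" "I \<noteq> {}" and k: "\<And>i. i \<in> I \<Longrightarrow> 1 \<le> k i" and D: "\<And>i. i \<in> I \<Longrightarrow> 1 \<le> D i"
    and B: "real B \<le> fact K * (\<Prod>i\<in>I. real (2 * D i) ^ k i / fact (k i))"
    and m: "2 ^ m \<le> B * (\<Sum>s\<le>K. 2 * m choose s)"
  shows "real m \<le> 2 * (\<Sum>i\<in>I. real (k i) * log 2 (4 * exp 1 * real (D i) * real K / real (k i)))"
proof -
  define A where "A = (\<Sum>i\<in>I. real (k i) * log 2 (4 * exp 1 * real (D i) * real K / real (k i)))"
  have kK: "k i \<le> K" if "i \<in> I" for i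
    unfolding K_def using I that by (intro member_le_sum) auto
  have K: "1 \<le> K" using I k kK by (metis all_not_in_conv le_trans)
  have "2 * real K = (\<Sum>i\<in>I. real (k i) * 2)" by (simp add: K_def sum_distrib_left mult.commute)
  also have "\<dots> \<le> A"
    unfolding A_def
  proof (intro sum_mono mult_left_mono)
    fix i assume i: "i \<in> I"
    have "1 \<le> real K / real (k i)" using k[OF i] kK[OF i] by (simp add: le_divide_eq)
    then have "1 * 1 \<le> real (D i) * (real K / real (k i))"
      using D[OF i] by (intro mult_mono) auto
    moreover have "(1::real) \<le> exp 1" by simp
    ultimately have "1 * 1 \<le> exp 1 * (real (D i) * (real K / real (k i)))"
      by (intro mult_mono) auto
    then have "log 2 (2 ^ 2) \<le> log 2 (4 * exp 1 * real (D i) * real K / real (k i))"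
      by (intro log_mono) auto
    then show "2 \<le> log 2 (4 * exp 1 * real (D i) * real K / real (k i))"
      by (subst (asm) log_pow_cancel) auto
  qed simp
  finally have A: "2 * real K \<le> A" .
  show ?thesis
  proof (cases "real m \<le> 4 * real K")
    case True
    then show ?thesis using A by (simp add: A_def)
  next
    case False
    define x where "x = real m / real K"
    have x: "4 \<le> x" using False K by (simp add: x_def field_simps)
    \<comment> \<open>Each factor is multiplied and divided by \<open>k i ^ k i\<close>, to bring in
      the multinomial estimate.\<close>
    have "fact K * (\<Prod>i\<in>I. real (2 * D i) ^ k i / fact (k i))
        = (\<Prod>i\<in>I. (2 * real (D i) / real (k i)) ^ k i)
          * (fact K * (\<Prod>i\<in>I. real (k i) ^ k i / fact (k i)))"
      using k by (force simp: power_divide simp flip: prod.distrib intro!: prod.cong)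
    also have "\<dots> \<le> (\<Prod>i\<in>I. (2 * real (D i) / real (k i)) ^ k i) * real K ^ K"
      unfolding K_def by (intro mult_left_mono fact_sum_le_power_sum I prod_nonneg) auto
    also have "\<dots> = (\<Prod>i\<in>I. (2 * real (D i) * real K / real (k i)) ^ k i)"
      by (simp add: K_def power_sum power_mult_distrib power_divide flip: prod.distrib)
    finally have B': "real B \<le> (\<Prod>i\<in>I. (2 * real (D i) * real K / real (k i)) ^ k i)"
      using B by linarith
    have "K \<le> 2 * m" using False by linarith
    then have "(\<Sum>s\<le>K. real (2 * m choose s)) \<le> (exp 1 * real (2 * m) / real K) ^ K"
      by (rule sum_binomial_le_exp_power[OF K])
    also have "\<dots> = (\<Prod>i\<in>I. (2 * exp 1 * x) ^ k i)"
      by (simp add: power_sum[symmetric] K_def[symmetric] x_def mult_ac)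
    finally have S: "(\<Sum>s\<le>K. real (2 * m choose s)) \<le> (\<Prod>i\<in>I. (2 * exp 1 * x) ^ k i)" .
    have "(2::real) ^ m \<le> real B * (\<Sum>s\<le>K. real (2 * m choose s))"
      using of_nat_mono[OF m, where 'a = real] by simp
    also have "\<dots> \<le> (\<Prod>i\<in>I. (2 * real (D i) * real K / real (k i)) ^ k i)
        * (\<Prod>i\<in>I. (2 * exp 1 * x) ^ k i)"
      by (intro mult_mono B' S prod_nonneg sum_nonneg) auto
    \<comment> \<open>The constant 4 is the 2 of the doubled degrees times the 2 of the two
      penalties per input; the factor \<open>exp 1\<close> comes from the binomial sum.\<close>
    also have "\<dots> = (\<Prod>i\<in>I. (4 * exp 1 * real (D i) * real K / real (k i) * x) ^ k i)"
      by (simp add: power_mult_distrib[symmetric] mult_ac flip: prod.distrib)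
    finally have "log 2 (2 ^ m)
        \<le> log 2 (\<Prod>i\<in>I. (4 * exp 1 * real (D i) * real K / real (k i) * x) ^ k i)"
      by (intro log_mono) auto
    also have "\<dots> = (\<Sum>i\<in>I. log 2 ((4 * exp 1 * real (D i) * real K / real (k i) * x) ^ k i))"
    proof -
      have "(4 * exp 1 * real (D i) * real K / real (k i) * x) ^ k i \<noteq> 0" if "i \<in> I" for i
        using k[OF that] D[OF that] K x by simp
      from ln_prod[OF I(1) this] show ?thesis
        by (simp only: log_def sum_divide_distrib)
    qed
    also have "\<dots> = (\<Sum>i\<in>I. real (k i) * (log 2 (4 * exp 1 * real (D i) * real K / real (k i)) + log 2 x))"
    proof (intro sum.cong refl)
      fix i assume i: "i \<in> I"
      have y: "0 < 4 * exp 1 * real (D i) * real K / real (k i)" using k[OF i] D[OF i] K by simp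
      have "0 < 4 * exp 1 * real (D i) * real K / real (k i) * x"
        by (rule mult_pos_pos[OF y]) (use x in simp)
      moreover have "log 2 (y * x) = log 2 y + log 2 x" if "0 < y" for y
        using x that by (simp add: log_mult)
      ultimately show "log 2 ((4 * exp 1 * real (D i) * real K / real (k i) * x) ^ k i)
          = real (k i) * (log 2 (4 * exp 1 * real (D i) * real K / real (k i)) + log 2 x)"
        using y by (simp only: log_nat_power)
    qed
    also have "\<dots> = A + real K * log 2 x"
      by (simp add: A_def K_def distrib_left sum.distrib sum_distrib_right)
    also have "\<dots> \<le> A + real K * (x / 2)"
      using log2_le_half[OF x] by (intro add_left_mono mult_left_mono) auto
    also have "real K * (x / 2) = real m / 2" using K by (simp add: x_def)
    finally have "real m \<le> A + real m / 2" by simp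
    then show ?thesis by (simp add: A_def)
  qed
qed

section \<open>Layered networks\<close>

lemma dcoef_Suc:
  "dcoef (Suc r) \<alpha> \<beta> (Suc r) = \<alpha> (Suc r)"
  "i \<le> r \<Longrightarrow> dcoef (Suc r) \<alpha> \<beta> i = dcoef r \<alpha> \<beta> i * \<beta> (Suc r)"
  by (simp_all add: dcoef_def mult.assoc)

text \<open>The induction treats the network cut off after layer \<open>r\<close>, hence
  \<open>dcoef r\<close>. Weights are indexed by pairs, so that \<open>fst\<close> is the block map;
  blocks after \<open>r\<close> have degree 0.\<close>

lemma layer_out_block_poly:
  assumes \<tau>: "\<forall>i\<in>{1..l}. \<forall>j<q i. poly_bideg (k i) (q (i - 1)) (\<alpha> i) (\<beta> i) (\<tau> i j)"
    and "r \<le> l" "j < q r"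
  shows "block_poly (SIGMA i:{1..l}. {..<k i}) fst
    (\<lambda>i. if 1 \<le> i \<and> i \<le> r then dcoef r \<alpha> \<beta> i else 0)
    (\<lambda>w. layer_out \<tau> (\<lambda>i a. w (i, a)) x r j)"
  using assms(2,3)
proof (induction r arbitrary: j)
  case 0
  have "finite (SIGMA i:{1..l}. {..<k i})" by simp
  from block_poly_const[OF this] show ?case by simp
next
  case (Suc r)
  let ?V = "SIGMA i:{1..l}. {..<k i}"
  let ?D = "\<lambda>r i. if 1 \<le> i \<and> i \<le> r then dcoef r \<alpha> \<beta> i else 0"
  let ?y = "\<lambda>w. layer_out \<tau> (\<lambda>i a. w (i, a)) x r"
  have V: "finite ?V" by simp
  have "poly_bideg (k (Suc r)) (q r) (\<alpha> (Suc r)) (\<beta> (Suc r)) (\<tau> (Suc r) j)"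
    using bspec[OF \<tau>, of "Suc r"] Suc.prems by simp
  then obtain c where c: "\<And>w y. \<tau> (Suc r) j w y
      = (\<Sum>e\<in>exps (k (Suc r)) (\<alpha> (Suc r)). \<Sum>g\<in>exps (q r) (\<beta> (Suc r)).
          c e g * (\<Prod>i<k (Suc r). w i ^ e i) * (\<Prod>j<q r. y j ^ g j))"
    unfolding poly_bideg_def by blast
  have "block_poly ?V fst (?D (Suc r))
      (\<lambda>w. c e g * (\<Prod>a<k (Suc r). w (Suc r, a) ^ e a) * (\<Prod>j<q r. ?y w j ^ g j))"
    if e: "e \<in> exps (k (Suc r)) (\<alpha> (Suc r))" and g: "g \<in> exps (q r) (\<beta> (Suc r))" for e g
  proof (rule block_poly_mono[OF V])
    show "block_poly ?V fst
      (\<lambda>i. (\<Sum>a<k (Suc r). e a * (if i = Suc r then 1 else 0)) + (\<Sum>j<q r. g j * ?D r i))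
      (\<lambda>w. c e g * (\<Prod>a<k (Suc r). w (Suc r, a) ^ e a) * (\<Prod>j<q r. ?y w j ^ g j))"
    proof (intro block_poly_mult block_poly_cmult block_poly_prod block_poly_power V)
      fix a assume "a \<in> {..<k (Suc r)}"
      then have "(Suc r, a) \<in> ?V" using Suc.prems by simp
      from block_poly_var[OF V this, of fst]
      show "block_poly ?V fst (\<lambda>i. if i = Suc r then 1 else 0) (\<lambda>w. w (Suc r, a))" by simp
    next
      fix j assume "j \<in> {..<q r}"
      then show "block_poly ?V fst (?D r) (\<lambda>w. ?y w j)" using Suc by simp
    qed
    fix i assume "i \<in> fst ` ?V"
    have "(\<Sum>a<k (Suc r). e a) \<le> \<alpha> (Suc r)" "(\<Sum>j<q r. g j) \<le> \<beta> (Suc r)"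
      using e g by (simp_all add: exps_def)
    \<comment> \<open>At most one summand is nonzero: earlier outputs do not involve the block
      \<open>Suc r\<close>, and the layer's own weights lie only in that block.\<close>
    then show "(\<Sum>a<k (Suc r). e a * (if i = Suc r then 1 else 0)) + (\<Sum>j<q r. g j * ?D r i)
        \<le> ?D (Suc r) i"
      by (cases "i = Suc r")
        (auto simp: dcoef_Suc mult.commute[of "dcoef r \<alpha> \<beta> i"] simp flip: sum_distrib_right)
  qed
  then have "block_poly ?V fst (?D (Suc r))
      (\<lambda>w. \<Sum>e\<in>exps (k (Suc r)) (\<alpha> (Suc r)). \<Sum>g\<in>exps (q r) (\<beta> (Suc r)).
        c e g * (\<Prod>a<k (Suc r). w (Suc r, a) ^ e a) * (\<Prod>j<q r. ?y w j ^ g j))"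
    by (intro block_poly_sum V)
  then show ?case by (simp add: c)
qed

text \<open>The total \<open>d\<close> cancels: dividing \<open>4 * exp 1 * d\<close> by v_i / u_i
  leaves \<open>4 * exp 1 * D i * K / k i\<close>.\<close>

lemma rel_entropy_bound_eq:
  assumes "\<And>i. i \<in> {1..l} \<Longrightarrow> 1 \<le> k i" "\<And>i. i \<in> {1..l} \<Longrightarrow> 1 \<le> D i"
    and "K = (\<Sum>i=1..l. k i)" "d = (\<Sum>i=1..l. D i)" "1 \<le> l"
  shows "real K * (log 2 (4 * exp 1 * real d)
      - rel_entropy l (\<lambda>i. real (k i) / real K) (\<lambda>i. real (D i) / real d))
    = (\<Sum>i=1..l. real (k i) * log 2 (4 * exp 1 * real (D i) * real K / real (k i)))"
proof -
  have pos: "0 < K" "0 < d"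
    using assms by (force intro!: sum_pos2[of _ 1])+
  have "real K * rel_entropy l (\<lambda>i. real (k i) / real K) (\<lambda>i. real (D i) / real d)
      = (\<Sum>i=1..l. real (k i) * log 2 (real (k i) / real K / (real (D i) / real d)))"
    using pos by (simp add: rel_entropy_def sum_distrib_left)
  moreover have "real K * log 2 (4 * exp 1 * real d)
      = (\<Sum>i=1..l. real (k i) * log 2 (4 * exp 1 * real d))"
    by (simp add: assms(3) sum_distrib_right)
  ultimately have "real K * (log 2 (4 * exp 1 * real d)
      - rel_entropy l (\<lambda>i. real (k i) / real K) (\<lambda>i. real (D i) / real d))
    = (\<Sum>i=1..l. real (k i) * (log 2 (4 * exp 1 * real d)
        - log 2 (real (k i) / real K / (real (D i) / real d))))"
    by (simp add: right_diff_distrib sum_subtractf)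
  also have "\<dots> = (\<Sum>i=1..l. real (k i) * log 2 (4 * exp 1 * real (D i) * real K / real (k i)))"
  proof (intro sum.cong refl arg_cong2[of _ _ _ _ "(*)"])
    fix i assume i: "i \<in> {1..l}"
    define y z where "y = 4 * exp 1 * real d" and "z = real (k i) / real K / (real (D i) / real d)"
    have p: "0 < real (k i)" "0 < real (D i)" using assms(1,2)[OF i] by simp_all
    then have "0 < y" "0 < z" using pos by (simp_all add: y_def z_def)
    then have "log 2 y - log 2 z = log 2 (y / z)" by (simp add: log_divide)
    also have "y / z = 4 * exp 1 * real (D i) * real K / real (k i)"
      using pos p by (simp add: y_def z_def)
    finally show "log 2 (4 * exp 1 * real d) - log 2 (real (k i) / real K / (real (D i) / real d))
        = log 2 (4 * exp 1 * real (D i) * real K / real (k i))"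
      by (simp only: y_def z_def)
  qed
  finally show ?thesis .
qed

theorem theorem4p1:
  fixes N l :: nat
    and q k \<alpha> \<beta> :: "nat \<Rightarrow> nat"
    and \<tau> :: "nat \<Rightarrow> nat \<Rightarrow> (nat \<Rightarrow> real) \<Rightarrow> (nat \<Rightarrow> real) \<Rightarrow> real"
  assumes "N \<ge> 1" and "l \<ge> 1"
    and "q 0 = N" and "q l = 1" and "\<forall>i\<in>{1..<l}. q i \<ge> 1"
    and "\<forall>i\<in>{1..l}. k i \<ge> 2"
    and "\<forall>i\<in>{1..l}. \<alpha> i \<ge> 1" and "\<forall>i\<in>{1..l}. \<beta> i \<ge> 1"
    and "\<forall>i\<in>{1..l}. \<forall>j<q i. poly_bideg (k i) (q (i - 1)) (\<alpha> i) (\<beta> i) (\<tau> i j)"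
  shows "let K = (\<Sum>i=1..l. k i);
             d = (\<Sum>i=1..l. dcoef l \<alpha> \<beta> i);
             v = (\<lambda>i. real (k i) / real K);
             u = (\<lambda>i. real (dcoef l \<alpha> \<beta> i) / real d)
         in vcdim_le {x. \<forall>j\<ge>N. x j = 0} {net_phi \<tau> l W | W. True}
              (2 * real K * (log 2 (4 * exp 1 * real d) - rel_entropy l v u))"
proof -
  define K where "K = (\<Sum>i=1..l. k i)"
  define D where "D = dcoef l \<alpha> \<beta>"
  define V where "V = (SIGMA i:{1..l}. {..<k i})"
  define \<phi> where "\<phi> x w = layer_out \<tau> (\<lambda>i a. w (i, a)) x l 0" for x and w :: "nat \<times> nat \<Rightarrow> real"
  have k: "1 \<le> k i" if "i \<in> {1..l}" for i using assms(6) that by force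
  have D: "1 \<le> D i" if "i \<in> {1..l}" for i
    using assms(7,8) that by (auto simp: D_def dcoef_def Suc_le_eq intro!: prod_pos)
  have V: "finite V" by (simp add: V_def)
  have fibre: "card {v\<in>V. fst v = i} = k i" if "i \<in> {1..l}" for i
  proof -
    have "{v\<in>V. fst v = i} = {i} \<times> {..<k i}" using that by (auto simp: V_def)
    then show ?thesis by (simp add: card_cartesian_product)
  qed
  have image: "fst ` V = {1..l}" using k by (force simp: V_def image_iff)
  have cardV: "card V = K" by (simp add: V_def K_def)
  have "block_poly V fst (\<lambda>i. if 1 \<le> i \<and> i \<le> l then dcoef l \<alpha> \<beta> i else 0) (\<phi> x)" for x
    using layer_out_block_poly[OF assms(9), of l 0 x] assms(4) by (simp add: V_def \<phi>_def[abs_def])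
  then have \<phi>: "block_poly V fst D (\<phi> x)" for x
    by (rule block_poly_mono[OF V]) (simp add: image D_def)
  \<comment> \<open>\<open>b\<close> need not be an integer. Its floor lies below \<open>b\<close>,
    as the size estimate requires, and its successor exceeds \<open>b\<close>, as the pattern count
    requires.\<close>
  define b where "b = fact K * (\<Prod>i=1..l. real (2 * D i) ^ k i / fact (k i))"
  have "b \<ge> 0" by (simp add: b_def prod_nonneg)
  have "real (card S) \<le> 2 * (\<Sum>i=1..l. real (k i) * log 2 (4 * exp 1 * real (D i) * real K / real (k i)))"
    if S: "finite S" "shatters {net_phi \<tau> l W | W. True} S" for S
    unfolding K_def
  proof (rule sample_size_bound[where B = "nat \<lfloor>b\<rfloor>"])
    have "\<exists>w. \<forall>x\<in>S. 0 \<le> \<phi> x w \<longleftrightarrow> x \<in> T" if "T \<in> Pow S" for T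
    proof -
      have "T \<subseteq> S" using that by simp
      with S(2) obtain f where f: "f \<in> {net_phi \<tau> l W | W. True}" "\<forall>x\<in>S. f x \<longleftrightarrow> x \<in> T"
        unfolding shatters_def by (elim allE[of _ T] impE bexE)
      from f(1) obtain W where "f = net_phi \<tau> l W" by (elim CollectE exE conjE)
      with f(2) show ?thesis by (intro exI[of _ "\<lambda>(i, a). W i a"]) (simp add: \<phi>_def net_phi_def)
    qed
    moreover have "fact (card V) * (\<Prod>i\<in>fst ` V. real (2 * D i) ^ card {v\<in>V. fst v = i}
        / fact (card {v\<in>V. fst v = i})) = b"
      by (simp add: image cardV b_def fibre)
    then have "fact (card V) * (\<Prod>i\<in>fst ` V. real (2 * D i) ^ card {v\<in>V. fst v = i}
        / fact (card {v\<in>V. fst v = i})) < real (Suc (nat \<lfloor>b\<rfloor>))"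
      using \<open>b \<ge> 0\<close> by linarith
    ultimately have "card (Pow S) \<le> nat \<lfloor>b\<rfloor> * (\<Sum>s\<le>card V. 2 * card S choose s)"
      using D by (intro card_sign_patterns_le[OF V S(1) \<phi>]) (auto simp: image)
    then show "2 ^ card S \<le> nat \<lfloor>b\<rfloor> * (\<Sum>s\<le>sum k {1..l}. 2 * card S choose s)"
      using S(1) by (simp add: card_Pow cardV K_def)
    show "real (nat \<lfloor>b\<rfloor>) \<le> fact (sum k {1..l}) * (\<Prod>i=1..l. real (2 * D i) ^ k i / fact (k i))"
      unfolding b_def[unfolded K_def, symmetric] using \<open>b \<ge> 0\<close> by linarith
  qed (use k D assms(2) in auto)
  then show ?thesis
    using rel_entropy_bound_eq[OF k D K_def refl assms(2)]
    unfolding Let_def vcdim_le_def K_def[symmetric] D_def by (simp add: mult.assoc)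
qed

end
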